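(* Let $n,d\ge 1$ be integers. Let $Z_1,\dots,Z_d$ be independent real-valued L\'evy processes, let $\boldsymbol{A}=(a_{mk})\in\mathbb{R}^{n\times d}$, and let $\boldsymbol{T}(t)=(T_1(t),\dots,T_d(t))$ be a L\'evy process on $\mathbb{R}_+^d$ with coordinatewise increasing trajectories (a multivariate subordinator), independent of $(Z_1,\dots,Z_d)$. Assume that the moment generating functions of $Z_1(1),\dots,Z_d(1)$ and of $\boldsymbol{T}(1)$ are finite in a neighbourhood of the origin. Let $$\boldsymbol{Y}(t)=\boldsymbol{A}\,\bigl(Z_1(T_1(t)),\dots,Z_d(T_d(t))\bigr)^{\top},\qquad \boldsymbol{Y}=\boldsymbol{Y}(1).$$ For every multi-index $\boldsymbol{i}\in\mathbb{N}^n$, the $\boldsymbol{i}$-th (joint) cumulant of $\boldsymbol{Y}$ is $$c_{\boldsymbol{i}}(\boldsymbol{Y})=E\bigl(\mathfrak{B}_{\boldsymbol{i}}(T_1,\dots,T_d)\bigr),$$ where $\mathfrak{B}_{\boldsymbol{i}}$ is the $\boldsymbol{i}$-th generalized (complete exponential) Bell polynomial $$\mathfrak{B}_{\boldsymbol{i}}(x_1,\dots,x_d)=\boldsymbol{i}!\sum_{\substack{\Lambda_1\vdash \boldsymbol{s}_1,\dots,\Lambda_d\vdash \boldsymbol{s}_d\\ \boldsymbol{s}_1+\cdots+\boldsymbol{s}_d=\boldsymbol{i}}} x_1^{l(\Lambda_1)}\cdots x_d^{l(\Lambda_d)}\,\frac{g_{1,\Lambda_1}\cdots g_{d,\Lambda_d}}{\Lambda_1!\cdots\Lambda_d!\;\mathfrak{m}(\Lambda_1)!\cdots\mathfrak{m}(\Lambda_d)!}$$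 (the sum being over all $\boldsymbol{s}_1,\dots,\boldsymbol{s}_d\in\mathbb{N}^n$ with sum $\boldsymbol{i}$ and all multi-index partitions $\Lambda_k$ of $\boldsymbol{s}_k$), and where: (i) $E$ is the linear operator on polynomials in the commuting indeterminates $T_1,\dots,T_d$ determined by $E(T_1^{j_1}\cdots T_d^{j_d})=c_{\boldsymbol{j}}(\boldsymbol{T})$ for $\boldsymbol{j}=(j_1,\dots,j_d)\in\mathbb{N}^d$, the $\boldsymbol{j}$-th joint cumulant of $\boldsymbol{T}=\boldsymbol{T}(1)$; (ii) for $k=1,\dots,d$, $g_{k,\Lambda}$ is the product associated through $\Lambda$ to the multi-indexed sequence $\{g_{k,\boldsymbol{\lambda}}\}$ given by $g_{k,\boldsymbol{\lambda}}=c_{|\boldsymbol{\lambda}|}(Z_k)\,(\boldsymbol{a}_{\cdot k})^{\boldsymbol{\lambda}}$, where $c_{j}(Z_k)$ denotes the $j$-th cumulant of $Z_k(1)$ and $\boldsymbol{a}_{\cdot k}=(a_{1k},\dots,a_{nk})$ is the $k$-th column of $\boldsymbol{A}$.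
   Context: Multi-indices: $\mathbb{N}=\{0,1,2,\dots\}$. For $\boldsymbol{\lambda}=(\lambda_1,\dots,\lambda_n)\in\mathbb{N}^n$ and $\boldsymbol{v}\in\mathbb{R}^n$, write $|\boldsymbol{\lambda}|=\lambda_1+\cdots+\lambda_n$, $\boldsymbol{\lambda}!=\lambda_1!\cdots\lambda_n!$ and $\boldsymbol{v}^{\boldsymbol{\lambda}}=v_1^{\lambda_1}\cdots v_n^{\lambda_n}$ (with $0^0=1$). Cumulants: for a random vector $\boldsymbol{X}$ in $\mathbb{R}^m$ whose moment generating function $M_{\boldsymbol{X}}(\boldsymbol{z})$ (the expectation of $e^{\boldsymbol{z}\cdot\boldsymbol{X}}$) is finite near the origin, the cumulant generating function is $K_{\boldsymbol{X}}(\boldsymbol{z})=\log M_{\boldsymbol{X}}(\boldsymbol{z})$, and for $\boldsymbol{j}\in\mathbb{N}^m$ the $\boldsymbol{j}$-th joint cumulant $c_{\boldsymbol{j}}(\boldsymbol{X})$ is the coefficient of $\boldsymbol{z}^{\boldsymbol{j}}/\boldsymbol{j}!$ in the power series expansion of $K_{\boldsymbol{X}}$ at the origin (so $c_{\boldsymbol{0}}(\boldsymbol{X})=0$). Cumulants of a L\'evy process refer to its time-one distribution. Multi-index partitions: a partition of a multi-index $\boldsymbol{s}=(s_1,\dots,s_n)\in\mathbb{N}^n$ is a matrix $\Lambda$ of non-negative integers with $n$ rows and no zero columns, with columns in lexicographic order, such that the entries of the $p$-th row sum to $s_p$ for $p=1,\dots,n$. One writes $\Lambda=(\boldsymbol{\lambda}_1^{r_1},\boldsymbol{\lambda}_2^{r_2},\dots)\vdash\boldsymbol{s}$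 when $\Lambda$ has $r_1$ columns equal to $\boldsymbol{\lambda}_1$, $r_2$ columns equal to $\boldsymbol{\lambda}_2$, and so on, with $\boldsymbol{\lambda}_1<\boldsymbol{\lambda}_2<\cdots$ the distinct columns. The vector of multiplicities is $\mathfrak{m}(\Lambda)=(r_1,r_2,\dots)$, with $\mathfrak{m}(\Lambda)!=r_1!\,r_2!\cdots$; the number of columns is $l(\Lambda)=r_1+r_2+\cdots$; and $\Lambda!=\prod_j(\boldsymbol{\lambda}_j!)^{r_j}$, the product being over the distinct columns. Given a multi-indexed sequence $\{g_{\boldsymbol{\lambda}}\}$, the product associated to it through $\Lambda$ is $g_\Lambda=\prod_j g_{\boldsymbol{\lambda}_j}^{r_j}$, over the distinct columns. The only partition of $\boldsymbol{0}$ is the empty one, for which $l(\Lambda)=0$ and $\Lambda!=\mathfrak{m}(\Lambda)!=g_\Lambda=1$. *)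

theory Defs
  imports
    "HOL-Probability.Probability"
    "HOL-Library.Fun_Lexorder"
    "HOL-Library.Poly_Mapping"
begin

section \<open>Multi-indices\<close>

definition mi_abs :: "nat ^ 'n \<Rightarrow> nat" where
  "mi_abs \<mu> = (\<Sum>p\<in>UNIV. \<mu> $ p)"

definition mi_fact :: "nat ^ 'n \<Rightarrow> real" where
  "mi_fact \<mu> = (\<Prod>p\<in>UNIV. fact (\<mu> $ p))"

definition mi_power :: "real ^ 'n \<Rightarrow> nat ^ 'n \<Rightarrow> real" where
  "mi_power v \<mu> = (\<Prod>p\<in>UNIV. (v $ p) ^ (\<mu> $ p))"

section \<open>Moment generating functions and cumulants\<close>

definition mgf :: "'a measure \<Rightarrow> ('a \<Rightarrow> 'b::euclidean_space) \<Rightarrow> 'b \<Rightarrow> real" where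
  "mgf M X z = (\<integral>\<omega>. exp (z \<bullet> X \<omega>) \<partial>M)"

text \<open>The integral is \<open>0\<close> for a non-integrable function, so that finiteness of the moment
  generating function is integrability of the exponential.\<close>

definition mgf_finite_near_0 :: "'a measure \<Rightarrow> ('a \<Rightarrow> 'b::euclidean_space) \<Rightarrow> bool" where
  "mgf_finite_near_0 M X \<longleftrightarrow>
     (\<exists>\<epsilon>>0. \<forall>z. norm z < \<epsilon> \<longrightarrow> integrable M (\<lambda>\<omega>. exp (z \<bullet> X \<omega>)))"

definition cgf :: "'a measure \<Rightarrow> ('a \<Rightarrow> 'b::euclidean_space) \<Rightarrow> 'b \<Rightarrow> real" where
  "cgf M X z = ln (mgf M X z)"

text \<open>\<open>joint_cumulant M X\<close> and \<open>cumulant M X\<close> are the unique families of Taylor coefficients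
  of the cumulant generating function at the origin; they carry information only if the moment
  generating function is finite near the origin.\<close>

definition has_joint_cumulants ::
  "'a measure \<Rightarrow> ('a \<Rightarrow> real ^ 'm) \<Rightarrow> (nat ^ 'm \<Rightarrow> real) \<Rightarrow> bool" where
  "has_joint_cumulants M X c \<longleftrightarrow> mgf_finite_near_0 M X \<and>
     (\<exists>\<epsilon>>0. \<forall>z. norm z < \<epsilon> \<longrightarrow>
        ((\<lambda>j. c j * (mi_power z j / mi_fact j)) has_sum cgf M X z) UNIV)"

definition joint_cumulant :: "'a measure \<Rightarrow> ('a \<Rightarrow> real ^ 'm) \<Rightarrow> nat ^ 'm \<Rightarrow> real" where
  "joint_cumulant M X = (THE c. has_joint_cumulants M X c)"

definition has_cumulants :: "'a measure \<Rightarrow> ('a \<Rightarrow> real) \<Rightarrow> (nat \<Rightarrow> real) \<Rightarrow> bool" where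
  "has_cumulants M X c \<longleftrightarrow> mgf_finite_near_0 M X \<and>
     (\<exists>\<epsilon>>0. \<forall>u. \<bar>u\<bar> < \<epsilon> \<longrightarrow> (\<lambda>j. c j * (u ^ j / fact j)) sums cgf M X u)"

definition cumulant :: "'a measure \<Rightarrow> ('a \<Rightarrow> real) \<Rightarrow> nat \<Rightarrow> real" where
  "cumulant M X = (THE c. has_cumulants M X c)"

section \<open>Levy processes and multivariate subordinators\<close>

text \<open>Processes are indexed by \<open>real\<close>; only the times \<open>t \<ge> 0\<close> are relevant.\<close>

definition cadlag :: "(real \<Rightarrow> 'b::topological_space) \<Rightarrow> bool" where
  "cadlag x \<longleftrightarrow>
     (\<forall>t\<ge>0. (x \<longlongrightarrow> x t) (at_right t)) \<and> (\<forall>t>0. \<exists>l. (x \<longlongrightarrow> l) (at_left t))"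

definition levy_process :: "'a measure \<Rightarrow> (real \<Rightarrow> 'a \<Rightarrow> 'b::euclidean_space) \<Rightarrow> bool" where
  "levy_process M X \<longleftrightarrow>
     (\<forall>t\<ge>0. X t \<in> borel_measurable M) \<and>
     (AE \<omega> in M. X 0 \<omega> = 0) \<and>
     (\<forall>(t :: nat \<Rightarrow> real) m. 0 \<le> t 0 \<longrightarrow> (\<forall>i<m. t i < t (Suc i)) \<longrightarrow>
        prob_space.indep_vars M (\<lambda>_. borel) (\<lambda>i \<omega>. X (t (Suc i)) \<omega> - X (t i) \<omega>) {..<m}) \<and>
     (\<forall>s\<ge>0. \<forall>h\<ge>0. distr M borel (\<lambda>\<omega>. X (s + h) \<omega> - X s \<omega>) = distr M borel (X h)) \<and>
     (\<forall>t\<ge>0. \<forall>\<epsilon>>0.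
        ((\<lambda>s. measure M {\<omega> \<in> space M. norm (X s \<omega> - X t \<omega>) > \<epsilon>}) \<longlongrightarrow> 0) (at t within {0..})) \<and>
     (\<forall>\<omega>\<in>space M. cadlag (\<lambda>t. X t \<omega>))"

definition multivariate_subordinator :: "'a measure \<Rightarrow> (real \<Rightarrow> 'a \<Rightarrow> real ^ 'd) \<Rightarrow> bool" where
  "multivariate_subordinator M T \<longleftrightarrow>
     levy_process M T \<and>
     (\<forall>\<omega>\<in>space M. \<forall>k. \<forall>t\<ge>0. 0 \<le> T t \<omega> $ k) \<and>
     (\<forall>\<omega>\<in>space M. \<forall>k. \<forall>s\<ge>0. \<forall>t\<ge>s. T s \<omega> $ k \<le> T t \<omega> $ k)"

text \<open>Independence of processes is independence of their paths, as random elements of the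
  product space over the time set.\<close>

definition path :: "(real \<Rightarrow> 'a \<Rightarrow> 'b) \<Rightarrow> 'a \<Rightarrow> real \<Rightarrow> 'b" where
  "path X \<omega> = (\<lambda>t\<in>{0..}. X t \<omega>)"

abbreviation path_space :: "(real \<Rightarrow> 'b::topological_space) measure" where
  "path_space \<equiv> PiM {0..} (\<lambda>_. borel)"

definition indep_processes ::
  "'a measure \<Rightarrow> ('k \<Rightarrow> real \<Rightarrow> 'a \<Rightarrow> 'b::topological_space) \<Rightarrow> bool" where
  "indep_processes M Z \<longleftrightarrow>
     prob_space.indep_vars M (\<lambda>_. path_space) (\<lambda>k. path (Z k)) UNIV"

definition indep_two_processes ::
  "'a measure \<Rightarrow> (real \<Rightarrow> 'a \<Rightarrow> 'b::topological_space) \<Rightarrow> (real \<Rightarrow> 'a \<Rightarrow> 'b) \<Rightarrow> bool" where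
  "indep_two_processes M X X' \<longleftrightarrow>
     prob_space.indep_var M path_space (path X) path_space (path X')"

definition joint_process :: "('d \<Rightarrow> real \<Rightarrow> 'a \<Rightarrow> real) \<Rightarrow> real \<Rightarrow> 'a \<Rightarrow> real ^ 'd" where
  "joint_process Z t \<omega> = (\<chi> k. Z k t \<omega>)"

definition subordinated_process ::
  "real ^ 'd ^ 'n \<Rightarrow> ('d \<Rightarrow> real \<Rightarrow> 'a \<Rightarrow> real) \<Rightarrow> (real \<Rightarrow> 'a \<Rightarrow> real ^ 'd) \<Rightarrow>
     real \<Rightarrow> 'a \<Rightarrow> real ^ 'n" where
  "subordinated_process A Z T t \<omega> = A *v (\<chi> k. Z k (T t \<omega> $ k) \<omega>)"

section \<open>Multi-index partitions\<close>

text \<open>A matrix is given by the list of its columns. The rows are indexed by a linearly ordered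
  finite type, the order being needed to compare columns lexicographically.\<close>

definition mi_lex_le :: "nat ^ 'n::{finite,linorder} \<Rightarrow> nat ^ 'n::{finite,linorder} \<Rightarrow> bool" where
  "mi_lex_le x y \<longleftrightarrow> x = y \<or> less_fun (($) x) (($) y)"

definition mi_partitions :: "nat ^ 'n::{finite,linorder} \<Rightarrow> (nat ^ 'n::{finite,linorder}) list set" where
  "mi_partitions s =
     {\<Lambda>. 0 \<notin> set \<Lambda> \<and> sorted_wrt mi_lex_le \<Lambda> \<and> (\<forall>p. (\<Sum>\<mu>\<leftarrow>\<Lambda>. \<mu> $ p) = s $ p)}"

text \<open>The distinct columns of \<open>\<Lambda>\<close> are the elements of \<open>set \<Lambda>\<close>, the multiplicity of \<open>\<mu>\<close> is
  \<open>count_list \<Lambda> \<mu>\<close>, and the number of columns is \<open>length \<Lambda>\<close>.\<close>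

definition mult_fact :: "(nat ^ 'n) list \<Rightarrow> real" where
  "mult_fact \<Lambda> = (\<Prod>\<mu>\<in>set \<Lambda>. fact (count_list \<Lambda> \<mu>))"

definition part_fact :: "(nat ^ 'n) list \<Rightarrow> real" where
  "part_fact \<Lambda> = (\<Prod>\<mu>\<in>set \<Lambda>. mi_fact \<mu> ^ count_list \<Lambda> \<mu>)"

definition part_prod :: "(nat ^ 'n \<Rightarrow> real) \<Rightarrow> (nat ^ 'n) list \<Rightarrow> real" where
  "part_prod g \<Lambda> = (\<Prod>\<mu>\<in>set \<Lambda>. g \<mu> ^ count_list \<Lambda> \<mu>)"

lemma finite_mi_le: "finite {x :: nat ^ 'n. \<forall>p. x $ p \<le> s $ p}"
proof (rule finite_subset)
  show "{x :: nat ^ 'n. \<forall>p. x $ p \<le> s $ p} \<subseteq> vec_lambda ` (PiE UNIV (\<lambda>p. {..s $ p}))"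
  proof
    fix x :: "nat ^ 'n" assume "x \<in> {x. \<forall>p. x $ p \<le> s $ p}"
    then have "($) x \<in> PiE UNIV (\<lambda>p. {..s $ p})" by auto
    moreover have "x = vec_lambda (($) x)" by (simp add: vec_nth_inverse)
    ultimately show "x \<in> vec_lambda ` (PiE UNIV (\<lambda>p. {..s $ p}))" by blast
  qed
qed (intro finite_imageI finite_PiE; simp)

lemma finite_mi_partitions: "finite (mi_partitions s)"
proof (rule finite_subset)
  show "mi_partitions s \<subseteq> {\<Lambda>. set \<Lambda> \<subseteq> {x. \<forall>p. x $ p \<le> s $ p} \<and> length \<Lambda> \<le> mi_abs s}"
  proof
    fix \<Lambda> assume L: "\<Lambda> \<in> mi_partitions s"
    have rows: "(\<Sum>\<mu>\<leftarrow>\<Lambda>. \<mu> $ p) = s $ p" for p using L by (simp add: mi_partitions_def)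
    have "x $ p \<le> s $ p" if "x \<in> set \<Lambda>" for x p
      using member_le_sum_list[of "x $ p" "map (\<lambda>\<mu>. \<mu> $ p) \<Lambda>"] that rows[of p] by auto
    moreover have "length \<Lambda> \<le> mi_abs s"
    proof -
      have pos: "1 \<le> mi_abs x" if "x \<in> set \<Lambda>" for x
      proof -
        have "x \<noteq> 0" using that L by (auto simp: mi_partitions_def)
        then obtain p where "x $ p \<noteq> 0" by (auto simp: vec_eq_iff)
        then show ?thesis
          using member_le_sum[of p UNIV "\<lambda>p. x $ p"] by (simp add: mi_abs_def)
      qed
      have "length \<Lambda> = (\<Sum>\<mu>\<leftarrow>\<Lambda>. 1)" by (simp add: sum_list_triv)
      also have "\<dots> \<le> (\<Sum>\<mu>\<leftarrow>\<Lambda>. mi_abs \<mu>)" by (rule sum_list_mono) (use pos in auto)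
      also have "\<dots> = (\<Sum>p\<in>UNIV. \<Sum>\<mu>\<leftarrow>\<Lambda>. \<mu> $ p)"
        by (induction \<Lambda>) (simp_all add: mi_abs_def sum.distrib)
      also have "\<dots> = mi_abs s" by (simp add: rows mi_abs_def)
      finally show ?thesis .
    qed
    ultimately show "\<Lambda> \<in> {\<Lambda>. set \<Lambda> \<subseteq> {x. \<forall>p. x $ p \<le> s $ p} \<and> length \<Lambda> \<le> mi_abs s}"
      by auto
  qed
qed (rule finite_lists_length_le[OF finite_mi_le])

section \<open>Polynomials in several indeterminates\<close>

text \<open>The ring structure on \<open>'d mpoly\<close> is the convolution ring of finitely supported functions:
  \<open>Poly_Mapping.single j c\<close> is the monomial with exponent \<open>j\<close> and coefficient \<open>c\<close>.\<close>

type_synonym 'd mpoly = "(nat ^ 'd) \<Rightarrow>\<^sub>0 real"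

definition mconst :: "real \<Rightarrow> 'd::finite mpoly" where
  "mconst c = Poly_Mapping.single 0 c"

definition indet :: "'d::finite \<Rightarrow> 'd mpoly" where
  "indet k = Poly_Mapping.single (axis k 1) 1"

definition umbral_eval :: "(nat ^ 'd \<Rightarrow> real) \<Rightarrow> 'd::finite mpoly \<Rightarrow> real" where
  "umbral_eval c p = (\<Sum>j\<in>Poly_Mapping.keys p. Poly_Mapping.lookup p j * c j)"

lemma umbral_eval_superset:
  assumes "finite S" "Poly_Mapping.keys p \<subseteq> S"
  shows "umbral_eval c p = (\<Sum>j\<in>S. Poly_Mapping.lookup p j * c j)"
  unfolding umbral_eval_def
  by (rule sum.mono_neutral_left) (use assms in \<open>auto simp: in_keys_iff\<close>)

lemma umbral_eval_add: "umbral_eval c (p + q) = umbral_eval c p + umbral_eval c q"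
proof -
  let ?S = "Poly_Mapping.keys p \<union> Poly_Mapping.keys q"
  have "Poly_Mapping.keys (p + q) \<subseteq> ?S" by (rule Poly_Mapping.keys_add)
  then show ?thesis
    by (simp add: umbral_eval_superset[of ?S] lookup_add algebra_simps sum.distrib)
qed

lemma lookup_mconst_times: "Poly_Mapping.lookup (mconst a * p) j = a * Poly_Mapping.lookup p j"
  by (simp add: mconst_def map.rep_eq when_def flip: mult_map_scale_conv_mult)

lemma umbral_eval_scale: "umbral_eval c (mconst a * p) = a * umbral_eval c p"
proof -
  have "Poly_Mapping.keys (mconst a * p) \<subseteq> Poly_Mapping.keys p"
    by (auto simp: in_keys_iff lookup_mconst_times)
  then show ?thesis
    by (simp add: umbral_eval_superset[of "Poly_Mapping.keys p"] lookup_mconst_times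
        sum_distrib_left mult.assoc)
qed

lemma indet_power: "indet k ^ m = Poly_Mapping.single (axis k m) 1"
proof (induction m)
  case 0
  have "axis k 0 = (0 :: nat ^ 'a)" by (simp add: vec_eq_iff axis_def)
  then show ?case by (metis power_0 single_one)
next
  case (Suc m)
  have "axis k 1 + axis k m = (axis k (Suc m) :: nat ^ 'a)" by (simp add: vec_eq_iff axis_def)
  then have "indet k * Poly_Mapping.single (axis k m) 1 = Poly_Mapping.single (axis k (Suc m)) 1"
    by (metis indet_def mult_single mult_1)
  then show ?case by (simp only: power_Suc Suc)
qed

lemma prod_indet_power: "(\<Prod>k\<in>UNIV. indet k ^ (j $ k)) = Poly_Mapping.single j 1"
proof -
  have "(\<Prod>k\<in>S. indet k ^ (j $ k)) = Poly_Mapping.single (\<Sum>k\<in>S. axis k (j $ k)) 1"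
    if "finite S" for S
    using that by (induction S) (simp_all add: indet_power mult_single)
  moreover have "(\<Sum>k\<in>UNIV. axis k (j $ k)) = j"
    by (simp add: vec_eq_iff axis_def sum.delta)
  ultimately show ?thesis by simp
qed

lemma umbral_eval_monomial: "umbral_eval c (\<Prod>k\<in>UNIV. indet k ^ (j $ k)) = c j"
  by (simp add: prod_indet_power umbral_eval_def)

section \<open>Generalized complete Bell polynomials\<close>

definition gen_bell ::
  "('d \<Rightarrow> nat ^ 'n::{finite,linorder} \<Rightarrow> real) \<Rightarrow> nat ^ 'n::{finite,linorder} \<Rightarrow>
     ('d::finite \<Rightarrow> 'd mpoly) \<Rightarrow> 'd mpoly" where
  "gen_bell g i x =
     mconst (mi_fact i) *
     (\<Sum>s\<in>{s. (\<Sum>k\<in>UNIV. s k) = i}.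
        \<Sum>\<Lambda>\<in>PiE UNIV (\<lambda>k. mi_partitions (s k)).
          (\<Prod>k\<in>UNIV. x k ^ length (\<Lambda> k)) *
          mconst ((\<Prod>k\<in>UNIV. part_prod (g k) (\<Lambda> k)) /
            ((\<Prod>k\<in>UNIV. part_fact (\<Lambda> k)) * (\<Prod>k\<in>UNIV. mult_fact (\<Lambda> k)))))"

lemma finite_decompositions: "finite {s :: 'd::finite \<Rightarrow> nat ^ 'n. (\<Sum>k\<in>UNIV. s k) = i}"
proof (rule finite_subset)
  show "{s :: 'd \<Rightarrow> nat ^ 'n. (\<Sum>k\<in>UNIV. s k) = i} \<subseteq> PiE UNIV (\<lambda>_. {x. \<forall>p. x $ p \<le> i $ p})"
  proof
    fix s :: "'d \<Rightarrow> nat ^ 'n" assume s: "s \<in> {s. (\<Sum>k\<in>UNIV. s k) = i}"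
    have "s k $ p \<le> i $ p" for k p
      using s member_le_sum[of k UNIV "\<lambda>k. s k $ p"] by (auto simp flip: sum_component)
    then show "s \<in> PiE UNIV (\<lambda>_. {x. \<forall>p. x $ p \<le> i $ p})" by auto
  qed
qed (intro finite_PiE finite_mi_le; simp)

end

(* Conditionally on T(1) = tau, the variables Z_k(tau_k) are independent with exponential moments
   exp (tau_k K_k(w_k)), K_k being the cumulant generating function of Z_k(1); integrating over tau,
   K_Y(z) = K_T(K_1(a_1 . z), ..., K_d(a_d . z)), where a_k is the k-th column of A.
   By the multinomial theorem K_k(a_k . z) has the coefficients g_{k,lambda} / lambda!, so the claim
   is a substitution of power series without constant term into the series of K_T.  Expanding the
   powers of the inner series gives a sum over families of lists of multi-indices, and sorting the
   lists collects it into a sum over multi-index partitions. *)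
theory Submission
  imports Defs "HOL-Combinatorics.Multiset_Permutations"
begin

section \<open>Multi-index powers\<close>

text \<open>Cumulants are given by \<open>THE\<close>, so coefficients can be compared only once a
  cumulant generating function is known to have exactly one convergent expansion at 0. Uniqueness
  rests on slicing a multivariate series one variable at a time. Existence is obtained from the same
  substitution result as the formula itself, with ln (1 + u) as outer series and u = M - 1, where M
  is the moment generating function. Series over families of lists have no natural enumeration;
  \<open>has_sum\<close> requires none, and for reals it amounts to absolute convergence.
  Substitution is then legitimate as soon as the inner series of absolute values also take values
  where the outer series converges. Vanishing constant terms guarantee this for small z. The
  conditioning on T(1) is carried out without conditional expectations: independence turns the joint
  law of the paths into a product measure, and Tonelli applies because all integrands are
  nonnegative. Integrability of exp (z . Y) is thus a conclusion of the computation.\<close>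

lemma mi_power_0 [simp]: "mi_power z 0 = 1"
  by (simp add: mi_power_def)

lemma mi_power_add: "mi_power z (i + j) = mi_power z i * mi_power z j"
  by (simp add: mi_power_def power_add prod.distrib)

lemma mi_power_sum: "mi_power z (\<Sum>k\<in>S. f k) = (\<Prod>k\<in>S. mi_power z (f k))"
  by (induction S rule: infinite_finite_induct) (simp_all add: mi_power_add)

lemma abs_mi_power: "\<bar>mi_power z j\<bar> = mi_power (\<chi> p. \<bar>z $ p\<bar>) j"
  by (simp add: mi_power_def abs_prod power_abs)

lemma mi_power_mono:
  assumes "\<And>p. 0 \<le> x $ p" "\<And>p. x $ p \<le> y $ p"
  shows "mi_power x j \<le> mi_power y j"
  unfolding mi_power_def by (rule prod_mono) (simp add: power_mono assms)

lemma mi_power_nonneg: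
  assumes "\<And>p. 0 \<le> x $ p"
  shows "0 \<le> mi_power x j"
  unfolding mi_power_def by (rule prod_nonneg) (simp add: assms)

lemma mi_power_scaleR: "mi_power (r *\<^sub>R z) j = r ^ mi_abs j * mi_power z j"
  by (simp add: mi_power_def mi_abs_def power_mult_distrib prod.distrib power_sum)

lemma mi_fact_pos: "0 < mi_fact j"
  unfolding mi_fact_def by (rule prod_pos) simp

lemma mi_fact_0 [simp]: "mi_fact 0 = 1"
  by (simp add: mi_fact_def)

lemma mi_abs_0 [simp]: "mi_abs 0 = 0"
  by (simp add: mi_abs_def)

lemma mi_abs_eq_0_iff: "mi_abs j = 0 \<longleftrightarrow> j = 0"
  by (auto simp: mi_abs_def vec_eq_iff)

section \<open>Unconditional sums of products\<close>

text \<open>Real summability is absolute, so the doubly indexed family is summable and its iterated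
  sum may be evaluated one index at a time.\<close>

lemma has_sum_times:
  fixes f :: "'a \<Rightarrow> real" and g :: "'b \<Rightarrow> real"
  assumes f: "(f has_sum a) A" and g: "(g has_sum b) B"
  shows "((\<lambda>(x, y). f x * g y) has_sum a * b) (A \<times> B)"
proof (rule has_sum_SigmaI)
  show "((\<lambda>y. case (x, y) of (x, y) \<Rightarrow> f x * g y) has_sum f x * b) B" for x
    using has_sum_cmult_right[OF g] by simp
  show "((\<lambda>x. f x * b) has_sum a * b) A"
    by (rule has_sum_cmult_left[OF f])
  have abs: "(\<lambda>x. \<bar>f x\<bar>) summable_on A" "(\<lambda>x. \<bar>g x\<bar>) summable_on B"
    using f g has_sum_imp_summable summable_on_iff_abs_summable_on_real by force+
  have "(\<lambda>(x, y). \<bar>f x\<bar> * \<bar>g y\<bar>) summable_on A \<times> B"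
  proof (rule summable_on_SigmaI)
    show "((\<lambda>y. case (x, y) of (x, y) \<Rightarrow> \<bar>f x\<bar> * \<bar>g y\<bar>) has_sum
        \<bar>f x\<bar> * infsum (\<lambda>y. \<bar>g y\<bar>) B) B" for x
      using has_sum_cmult_right[OF has_sum_infsum[OF abs(2)]] by simp
    show "(\<lambda>x. \<bar>f x\<bar> * infsum (\<lambda>y. \<bar>g y\<bar>) B) summable_on A"
      by (rule summable_on_cmult_left[OF abs(1)])
  qed auto
  then show "(\<lambda>(x, y). f x * g y) summable_on A \<times> B"
    by (subst summable_on_iff_abs_summable_on_real) (simp add: case_prod_unfold abs_mult)
qed

text \<open>Absolute summability comes from a uniform bound on finite partial sums: enlarge a finite
  set of choice functions to a finite box, factor the sum over the box, and bound each factor by a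
  full series.\<close>

lemma has_sum_prod_PiE:
  fixes f :: "'a \<Rightarrow> 'b \<Rightarrow> real"
  assumes "finite A" and f: "\<And>x. x \<in> A \<Longrightarrow> (f x has_sum s x) (B x)"
  shows "((\<lambda>g. \<Prod>x\<in>A. f x (g x)) has_sum (\<Prod>x\<in>A. s x)) (PiE A B)"
proof -
  have abs: "(\<lambda>y. norm (f x y)) summable_on B x" if "x \<in> A" for x
    using f[OF that] has_sum_imp_summable summable_on_iff_abs_summable_on_real by blast
  have "(\<lambda>g. norm (\<Prod>x\<in>A. f x (g x))) summable_on PiE A B"
    unfolding abs_summable_iff_bdd_above
  proof (rule bdd_aboveI2)
    fix F assume F: "F \<in> {F. F \<subseteq> PiE A B \<and> finite F}"
    \<comment> \<open>The box spanned by \<open>F\<close>: in coordinate x exactly the values taken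
      there by members of \<open>F\<close>.\<close>
    let ?C = "\<lambda>x. (\<lambda>g. g x) ` F"
    have "(\<Sum>g\<in>F. norm (\<Prod>x\<in>A. f x (g x))) \<le> (\<Sum>g\<in>PiE A ?C. norm (\<Prod>x\<in>A. f x (g x)))"
    proof (rule sum_mono2)
      show "finite (PiE A ?C)" using F assms(1) by (auto intro: finite_PiE)
      show "F \<subseteq> PiE A ?C" using F by (auto simp: PiE_def)
    qed simp
    also have "\<dots> = (\<Prod>x\<in>A. \<Sum>y\<in>?C x. norm (f x y))"
      using F assms(1) by (subst prod_sum_PiE) (auto simp: abs_prod)
    also have "\<dots> \<le> (\<Prod>x\<in>A. infsum (\<lambda>y. norm (f x y)) (B x))"
      by (intro prod_mono conjI sum_nonneg finite_sum_le_infsum) (use F abs in \<open>auto simp: PiE_def\<close>)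
    finally show "(\<Sum>g\<in>F. norm (\<Prod>x\<in>A. f x (g x)))
        \<le> (\<Prod>x\<in>A. infsum (\<lambda>y. norm (f x y)) (B x))" .
  qed
  then have "(\<lambda>g. \<Prod>x\<in>A. f x (g x)) summable_on PiE A B"
    by (rule abs_summable_summable)
  moreover have "infsum (\<lambda>g. \<Prod>x\<in>A. f x (g x)) (PiE A B) = (\<Prod>x\<in>A. s x)"
    using infsum_prod_PiE_abs[OF assms(1) abs] infsumI[OF f] by simp
  ultimately show ?thesis by (simp add: has_sum_iff)
qed

text \<open>Multiplying out the m-th power yields one term for each ordered choice of a summand from
  every factor. Keeping the order postpones all counting of multiplicities to the final
  sorting.\<close>

lemma has_sum_lists_length:
  fixes u :: "'a \<Rightarrow> real"
  assumes u: "(u has_sum s) UNIV"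
  shows "((\<lambda>l. \<Prod>x\<leftarrow>l. u x) has_sum s ^ m) {l. length l = m}"
proof (induction m)
  case 0
  have "{l :: 'a list. length l = 0} = {[]}" by auto
  then show ?case by (simp add: has_sum_finiteI)
next
  case (Suc m)
  have bij: "bij_betw (\<lambda>(x, l). x # l) (UNIV \<times> {l :: 'a list. length l = m}) {l. length l = Suc m}"
    by (rule bij_betwI[where g = "\<lambda>l. (hd l, tl l)"]) (auto simp: length_Suc_conv)
  have "((\<lambda>(x, l). u x * (\<Prod>x\<leftarrow>l. u x)) has_sum s * s ^ m) (UNIV \<times> {l. length l = m})"
    by (rule has_sum_times[OF u Suc])
  then have "((\<lambda>y. \<Prod>x\<leftarrow>(\<lambda>(x, l). x # l) y. u x) has_sum s ^ Suc m) (UNIV \<times> {l. length l = m})"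
    by (simp add: case_prod_unfold)
  then show ?case
    using has_sum_reindex_bij_betw[OF bij, of "\<lambda>l. \<Prod>x\<leftarrow>l. u x"] by simp
qed

section \<open>Multivariate power series\<close>

text \<open>Once the lower coefficients vanish, dividing by x^m leaves a series with constant term
  \<open>c m\<close> and sum 0 at every small x \<noteq> 0; its limit at 0 is therefore both
  \<open>c m\<close> and 0.\<close>

lemma powser_zero_coeffs:
  fixes c :: "nat \<Rightarrow> real"
  assumes "r > 0" and c: "\<And>x. x \<noteq> 0 \<Longrightarrow> \<bar>x\<bar> < r \<Longrightarrow> (\<lambda>n. c n * x ^ n) sums 0"
  shows "c m = 0"
proof (induction m rule: less_induct)
  case (less m)
  have "((\<lambda>_. 0) \<longlongrightarrow> c (0 + m)) (at (0 :: real))"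
  proof (rule powser_limit_0_strong[where s = r and a = "\<lambda>n. c (n + m)"])
    fix x :: real assume x: "x \<noteq> 0" "norm x < r"
    have "(\<lambda>n. c (n + m) * x ^ (n + m)) sums 0"
      by (subst sums_zero_iff_shift[of m "\<lambda>n. c n * x ^ n"]) (use less c x in auto)
    from sums_mult[OF this, of "1 / x ^ m"] show "(\<lambda>n. c (n + m) * x ^ n) sums 0"
      using x by (simp add: power_add)
  qed (rule \<open>r > 0\<close>)
  from LIM_const_eq[OF this] show ?case by simp
qed

definition has_mps :: "(nat ^ 'n \<Rightarrow> real) \<Rightarrow> (real ^ 'n \<Rightarrow> real) \<Rightarrow> bool" where
  "has_mps c f \<longleftrightarrow>
     (\<exists>\<epsilon>>0. \<forall>z. norm z < \<epsilon> \<longrightarrow> ((\<lambda>j. c j * mi_power z j) has_sum f z) UNIV)"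

text \<open>Induction on the set \<open>S\<close> of variables that actually occur. For a new
  variable q the series is a one-variable power series in z_q whose coefficients are series in the
  old variables, and all of these vanish. The domain is a cube, not a ball, so that z_q can vary
  freely while the other coordinates stay fixed.\<close>

lemma has_mps_zero_coeffs:
  fixes c :: "nat ^ 'n \<Rightarrow> real"
  assumes "\<rho> > 0" "finite S"
    and "\<And>z. (\<And>p. \<bar>z $ p\<bar> < \<rho>) \<Longrightarrow> ((\<lambda>j. c j * mi_power z j) has_sum 0) {j. \<forall>p. p \<notin> S \<longrightarrow> j $ p = 0}"
    and "\<forall>p. p \<notin> S \<longrightarrow> j $ p = 0"
  shows "c j = 0"
  using assms(2-)
proof (induction S arbitrary: c j)
  case empty
  have "{j :: nat ^ 'n. \<forall>p. p \<notin> {} \<longrightarrow> j $ p = 0} = {0}" by (auto simp: vec_eq_iff)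
  moreover have "j = 0" using empty(2) by (simp add: vec_eq_iff)
  ultimately show ?case
    using empty(1)[of 0] \<open>\<rho> > 0\<close> has_sum_finite_iff[of "{0 :: nat ^ 'n}" "\<lambda>j. c j * mi_power 0 j" 0]
    by simp
next
  case (insert q S)
  let ?J = "\<lambda>S. {j :: nat ^ 'n. \<forall>p. p \<notin> S \<longrightarrow> j $ p = 0}"
  \<comment> \<open>Splits a multi-index into its exponent m at q and the remaining
    exponents.\<close>
  define h where "h = (\<lambda>(m :: nat, j :: nat ^ 'n). j + axis q m)"
  have bij: "bij_betw h (UNIV \<times> ?J S) (?J (insert q S))"
    by (rule bij_betwI[where g = "\<lambda>j. (j $ q, \<chi> p. if p = q then 0 else j $ p)"])
      (use insert(2) in \<open>auto simp: h_def axis_def vec_eq_iff\<close>)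
  have pow: "mi_power (\<chi> p. if p = q then x else z $ p) (h (m, j)) = x ^ m * mi_power z j"
    if "j \<in> ?J S" for x :: real and z m j
  proof -
    have "mi_power (\<chi> p. if p = q then x else z $ p) (axis q m) = x ^ m"
      unfolding mi_power_def by (subst prod.remove[of _ q]) (auto simp: axis_def intro!: prod.neutral)
    moreover have "mi_power (\<chi> p. if p = q then x else z $ p) j = mi_power z j"
      unfolding mi_power_def by (rule prod.cong) (use that insert(2) in auto)
    ultimately show ?thesis by (simp add: h_def mi_power_add)
  qed
  have slice: "((\<lambda>j. c (j + axis q m) * mi_power z j) has_sum 0) (?J S)"
    if z: "\<And>p. \<bar>z $ p\<bar> < \<rho>" for z m
  proof -
    define G where "G m = infsum (\<lambda>j. c (j + axis q m) * mi_power z j) (?J S)" for m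
    have tot: "((\<lambda>(m, j). x ^ m * (c (j + axis q m) * mi_power z j)) has_sum 0) (UNIV \<times> ?J S)"
      if "\<bar>x\<bar> < \<rho>" for x
    proof -
      have "((\<lambda>y. c (h y) * mi_power (\<chi> p. if p = q then x else z $ p) (h y)) has_sum 0) (UNIV \<times> ?J S)"
        by (subst has_sum_reindex_bij_betw[OF bij, of "\<lambda>j. c j * mi_power (\<chi> p. if p = q then x else z $ p) j"])
          (rule insert.prems(1), use z that in auto)
      then show ?thesis
        by (rule has_sum_cong[THEN iffD1, rotated]) (auto simp: pow[unfolded h_def prod.case] h_def)
    qed
    \<comment> \<open>Any nonzero x in the domain serves; \<rho>/2 is one, and its power can be
      divided out.\<close>
    have summ: "(\<lambda>j. c (j + axis q m) * mi_power z j) summable_on ?J S" for m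
    proof -
      have "(\<lambda>j. (\<rho>/2) ^ m * (c (j + axis q m) * mi_power z j)) summable_on ?J S"
        using summable_on_SigmaD1[OF has_sum_imp_summable[OF tot[of "\<rho>/2"]], of m] \<open>\<rho> > 0\<close> by simp
      then show ?thesis
        using \<open>\<rho> > 0\<close> by (subst (asm) summable_on_cmult_right') auto
    qed
    have "(\<lambda>m. G m * x ^ m) sums 0" if "\<bar>x\<bar> < \<rho>" for x
    proof -
      have "((\<lambda>m. G m * x ^ m) has_sum 0) UNIV"
      proof (rule has_sum_SigmaD[OF tot[of x]])
        show "((\<lambda>j. case (m, j) of (m, j) \<Rightarrow> x ^ m * (c (j + axis q m) * mi_power z j)) has_sum G m * x ^ m) (?J S)" for m
          using has_sum_cmult_right[OF has_sum_infsum[OF summ[of m]], of "x ^ m"]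
          by (simp add: G_def mult.commute)
      qed (use that in simp)
      then show ?thesis by (rule has_sum_imp_sums)
    qed
    then have "G m = 0"
      using powser_zero_coeffs[OF \<open>\<rho> > 0\<close>] by blast
    then show ?thesis using summ[of m] by (simp add: G_def has_sum_iff)
  qed
  obtain m j' where j: "j = j' + axis q m" and j': "j' \<in> ?J S"
    using bij insert.prems(2) by (force simp: bij_betw_def h_def)
  show ?case
    using insert.IH[of "\<lambda>j. c (j + axis q m)" j'] slice j j' by auto
qed

lemma has_mps_unique:
  fixes c c' :: "nat ^ 'n \<Rightarrow> real"
  assumes "has_mps c f" "has_mps c' f"
  shows "c = c'"
proof
  fix j
  obtain e where e: "e > 0" "\<And>z. norm z < e \<Longrightarrow> ((\<lambda>j. c j * mi_power z j) has_sum f z) UNIV"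
    using assms(1) by (auto simp: has_mps_def)
  obtain e' where e': "e' > 0" "\<And>z. norm z < e' \<Longrightarrow> ((\<lambda>j. c' j * mi_power z j) has_sum f z) UNIV"
    using assms(2) by (auto simp: has_mps_def)
  \<comment> \<open>The Euclidean norm is at most the sum of the absolute coordinates, so the cube
    of this half-width lies in both balls.\<close>
  define \<rho> where "\<rho> = min e e' / CARD('n)"
  have "\<rho> > 0" using e(1) e'(1) by (simp add: \<rho>_def)
  have "c j - c' j = 0"
  proof (rule has_mps_zero_coeffs[of \<rho> UNIV "\<lambda>j. c j - c' j" j, OF \<open>\<rho> > 0\<close>])
    fix z :: "real ^ 'n" assume z: "\<And>p. \<bar>z $ p\<bar> < \<rho>"
    have "norm z \<le> (\<Sum>p\<in>UNIV. \<bar>z $ p\<bar>)" by (rule norm_le_l1_cart)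
    also have "\<dots> < (\<Sum>p\<in>(UNIV :: 'n set). \<rho>)" by (rule sum_strict_mono) (use z in auto)
    also have "\<dots> = min e e'" by (simp add: \<rho>_def)
    finally have "norm z < e" "norm z < e'" by auto
    from has_sum_add[OF e(2)[OF this(1)] has_sum_uminusI[OF e'(2)[OF this(2)]]]
    show "((\<lambda>j. (c j - c' j) * mi_power z j) has_sum 0) {j. \<forall>p. p \<notin> UNIV \<longrightarrow> j $ p = 0}"
      by (simp add: algebra_simps)
  qed auto
  then show "c j = c' j" by simp
qed

text \<open>Without a constant term, every monomial shrinks at least by the factor t when the point
  is scaled by t \<le> 1. The absolute series at a fixed diagonal point therefore dominates, with
  factor t, the absolute series at all points near 0.\<close>

lemma has_mps_abs_small:
  fixes c :: "nat ^ 'n \<Rightarrow> real"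
  assumes "has_mps c f" "c 0 = 0" "e > 0"
  obtains \<delta> where "\<delta> > 0"
    "\<And>z. norm z < \<delta> \<Longrightarrow> \<exists>B\<le>e. ((\<lambda>j. \<bar>c j * mi_power z j\<bar>) has_sum B) UNIV"
proof -
  obtain r where r: "r > 0" "\<And>z. norm z < r \<Longrightarrow> ((\<lambda>j. c j * mi_power z j) has_sum f z) UNIV"
    using assms(1) by (auto simp: has_mps_def)
  \<comment> \<open>The factor 2 keeps the diagonal point \<open>z0\<close> strictly inside the ball
    of convergence.\<close>
  define \<rho> where "\<rho> = r / (2 * CARD('n))"
  define z0 :: "real ^ 'n" where "z0 = (\<chi> p. \<rho>)"
  have "\<rho> > 0" using r(1) by (simp add: \<rho>_def)
  have "norm z0 \<le> (\<Sum>p\<in>UNIV. \<bar>z0 $ p\<bar>)" by (rule norm_le_l1_cart)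
  also have "\<dots> < r" using r(1) by (simp add: z0_def \<rho>_def)
  finally have "(\<lambda>j. c j * mi_power z0 j) summable_on UNIV"
    using r(2) has_sum_imp_summable by blast
  then have summ: "(\<lambda>j. \<bar>c j * mi_power z0 j\<bar>) summable_on UNIV"
    using summable_on_iff_abs_summable_on_real by (metis (no_types, lifting) real_norm_def summable_on_cong)
  define C where "C = infsum (\<lambda>j. \<bar>c j * mi_power z0 j\<bar>) UNIV"
  have C: "C \<ge> 0" unfolding C_def by (rule infsum_nonneg) simp
  \<comment> \<open>The bound 1 gives t^|j| \<le> t for j \<noteq> 0; the summand 1 keeps the
    denominator positive when C = 0.\<close>
  define t where "t = min 1 (e / (C + 1))"
  have t: "0 < t" "t \<le> 1" "t * C \<le> e"
  proof -
    show "0 < t" "t \<le> 1" using C assms(3) by (auto simp: t_def)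
    have "t * C \<le> e / (C + 1) * C" by (rule mult_right_mono) (use C in \<open>auto simp: t_def\<close>)
    also have "\<dots> \<le> e" using C assms(3) by (simp add: divide_simps mult_left_mono)
    finally show "t * C \<le> e" .
  qed
  show ?thesis
  proof (rule that[of "t * \<rho>"])
    show "t * \<rho> > 0" using t \<open>\<rho> > 0\<close> by simp
    fix z :: "real ^ 'n" assume z: "norm z < t * \<rho>"
    have le: "\<bar>c j * mi_power z j\<bar> \<le> t * \<bar>c j * mi_power z0 j\<bar>" for j
    proof (cases "j = 0")
      case False
      have "\<bar>mi_power z j\<bar> \<le> mi_power (t *\<^sub>R z0) j"
        unfolding abs_mi_power using z component_le_norm_cart[of z] \<open>\<rho> > 0\<close> t
        by (intro mi_power_mono) (auto simp: z0_def intro: order_trans less_imp_le)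
      also have "\<dots> = t ^ mi_abs j * mi_power z0 j" by (rule mi_power_scaleR)
      also have "\<dots> \<le> t ^ 1 * mi_power z0 j"
      proof (intro mult_right_mono power_decreasing mi_power_nonneg)
        show "1 \<le> mi_abs j" using False mi_abs_eq_0_iff[of j] by simp
      qed (use t \<open>\<rho> > 0\<close> in \<open>auto simp: z0_def\<close>)
      finally have "\<bar>mi_power z j\<bar> \<le> t * \<bar>mi_power z0 j\<bar>"
        using t by (simp add: mult_left_mono order_trans)
      from mult_left_mono[OF this abs_ge_zero[of "c j"]]
      show ?thesis by (simp add: abs_mult algebra_simps)
    qed (simp add: assms(2))
    have st: "(\<lambda>j. t * \<bar>c j * mi_power z0 j\<bar>) summable_on UNIV"
      by (rule summable_on_cmult_right[OF summ])
    have s: "(\<lambda>j. \<bar>c j * mi_power z j\<bar>) summable_on UNIV"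
      by (rule summable_on_comparison_test[OF st]) (use le in auto)
    have "infsum (\<lambda>j. \<bar>c j * mi_power z j\<bar>) UNIV \<le> infsum (\<lambda>j. t * \<bar>c j * mi_power z0 j\<bar>) UNIV"
      by (rule infsum_mono[OF s st]) (rule le)
    also have "\<dots> = t * C" unfolding C_def by (rule infsum_cmult_right) (use summ in simp)
    also have "\<dots> \<le> e" by (rule t)
    finally show "\<exists>B\<le>e. ((\<lambda>j. \<bar>c j * mi_power z j\<bar>) has_sum B) UNIV"
      using s by (auto simp: has_sum_iff)
  qed
qed

section \<open>Composition of power series\<close>

text \<open>Excluding zero entries makes the set finite; it loses no term of a composition whose
  inner series have no constant term.\<close>

definition decomp_lists :: "nat ^ 'n \<Rightarrow> ('d::finite \<Rightarrow> (nat ^ 'n) list) set" where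
  "decomp_lists i = {L. (\<forall>k. 0 \<notin> set (L k)) \<and> (\<Sum>k\<in>UNIV. sum_list (L k)) = i}"

text \<open>The coefficient of z^i in \<Sum>j. a_j \<Prod>k. (\<Sum>\<mu>. b_k(\<mu>)
  z^\<mu>)^(j_k). Each power is multiplied out into ordered lists, so j reappears as the vector of
  list lengths.\<close>

definition comp_coeff ::
  "(nat ^ 'd \<Rightarrow> real) \<Rightarrow> ('d::finite \<Rightarrow> nat ^ 'n \<Rightarrow> real) \<Rightarrow> nat ^ 'n \<Rightarrow> real" where
  "comp_coeff a b i =
     (\<Sum>L\<in>decomp_lists i. a (\<chi> k. length (L k)) * (\<Prod>k\<in>UNIV. \<Prod>\<mu>\<leftarrow>L k. b k \<mu>))"

lemma length_le_mi_abs_sum_list: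
  "0 \<notin> set l \<Longrightarrow> length l \<le> mi_abs (sum_list l)"
proof (induction l)
  case (Cons x l)
  have "1 \<le> mi_abs x" using Cons.prems mi_abs_eq_0_iff[of x] by auto
  then show ?case using Cons by (simp add: mi_abs_def sum.distrib)
qed simp

lemma sum_list_component: "(sum_list l :: nat ^ 'n) $ p = (\<Sum>\<mu>\<leftarrow>l. \<mu> $ p)"
  by (induction l) simp_all

text \<open>Every entry is bounded componentwise by i, and each nonzero entry uses up at least one
  unit of the total degree, which bounds the lengths.\<close>

lemma finite_decomp_lists: "finite (decomp_lists i :: ('d::finite \<Rightarrow> (nat ^ 'n) list) set)"
proof (rule finite_subset)
  let ?X = "{l. set l \<subseteq> {x. \<forall>p. x $ p \<le> i $ p} \<and> length l \<le> mi_abs i}"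
  show "finite (PiE (UNIV :: 'd set) (\<lambda>_. ?X))"
    by (intro finite_PiE finite_lists_length_le finite_mi_le) simp
  show "decomp_lists i \<subseteq> PiE (UNIV :: 'd set) (\<lambda>_. ?X)"
  proof
    fix L :: "'d \<Rightarrow> (nat ^ 'n) list" assume "L \<in> decomp_lists i"
    then have nz: "0 \<notin> set (L k)" and s: "(\<Sum>k\<in>UNIV. sum_list (L k)) = i" for k
      by (auto simp: decomp_lists_def)
    have le: "sum_list (L k) $ p \<le> i $ p" for k p
      using member_le_sum[of k UNIV "\<lambda>k. sum_list (L k) $ p"] by (simp flip: s)
    have "x $ p \<le> i $ p" if "x \<in> set (L k)" for x k p
      using member_le_sum_list[of "x $ p" "map (\<lambda>\<mu>. \<mu> $ p) (L k)"] that le[of k p]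
      by (auto simp: sum_list_component)
    moreover have "length (L k) \<le> mi_abs i" for k
    proof -
      have "length (L k) \<le> mi_abs (sum_list (L k))" by (rule length_le_mi_abs_sum_list[OF nz])
      also have "\<dots> \<le> mi_abs i" unfolding mi_abs_def by (intro sum_mono le)
      finally show ?thesis .
    qed
    ultimately show "L \<in> PiE UNIV (\<lambda>_. ?X)" by auto
  qed
qed

text \<open>One summable family \<open>f\<close> over all families of lists is grouped in two ways:
  by the vector of lengths, which gives the outer series at w, and by the total of all entries,
  which gives the coefficients of z^i. The vector w' collects the inner sums of absolute
  values.\<close>

lemma has_sum_compose_pointwise:
  fixes a :: "nat ^ 'd \<Rightarrow> real" and b :: "'d::finite \<Rightarrow> nat ^ 'n \<Rightarrow> real"
  assumes b0: "\<And>k. b k 0 = 0"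
    and W: "\<And>k. ((\<lambda>\<mu>. b k \<mu> * mi_power z \<mu>) has_sum w $ k) UNIV"
    and B: "\<And>k. ((\<lambda>\<mu>. \<bar>b k \<mu> * mi_power z \<mu>\<bar>) has_sum w' $ k) UNIV"
    and F: "((\<lambda>j. a j * mi_power w j) has_sum F) UNIV"
    and F': "(\<lambda>j. a j * mi_power w' j) summable_on UNIV"
  shows "((\<lambda>i. comp_coeff a b i * mi_power z i) has_sum F) UNIV"
proof -
  define LL where "LL j = {L :: 'd \<Rightarrow> (nat ^ 'n) list. \<forall>k. length (L k) = j $ k}" for j :: "nat ^ 'd"
  have LL: "LL j = PiE UNIV (\<lambda>k. {l. length l = j $ k})" for j
    by (auto simp: LL_def)
  define f where "f L = a (\<chi> k. length (L k)) * (\<Prod>k\<in>UNIV. \<Prod>\<mu>\<leftarrow>L k. b k \<mu> * mi_power z \<mu>)" for L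
  have w': "0 \<le> w' $ k" for k using has_sum_nonneg[OF B] by simp
  have len: "(\<chi> k. length (L k)) = j" if "L \<in> LL j" for L j
    using that by (simp add: LL_def vec_eq_iff)
  have f_sum: "(f has_sum a j * mi_power w j) (LL j)" for j
  proof -
    have "((\<lambda>L. \<Prod>k\<in>UNIV. \<Prod>\<mu>\<leftarrow>L k. b k \<mu> * mi_power z \<mu>) has_sum (\<Prod>k\<in>UNIV. (w $ k) ^ (j $ k))) (LL j)"
      unfolding LL by (rule has_sum_prod_PiE) (auto intro: has_sum_lists_length W)
    from has_sum_cmult_right[OF this, of "a j"] show ?thesis
      unfolding mi_power_def[of w] by (rule has_sum_cong[THEN iffD1, rotated]) (simp add: f_def len mi_power_def)
  qed
  have abs_list: "\<bar>\<Prod>\<mu>\<leftarrow>l. u \<mu>\<bar> = (\<Prod>\<mu>\<leftarrow>l. \<bar>u \<mu> :: real\<bar>)" for u and l :: "(nat ^ 'n) list"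
    by (induction l) (simp_all add: abs_mult)
  have f_abs: "((\<lambda>L. \<bar>f L\<bar>) has_sum \<bar>a j * mi_power w' j\<bar>) (LL j)" for j
  proof -
    have "((\<lambda>L. \<Prod>k\<in>UNIV. \<Prod>\<mu>\<leftarrow>L k. \<bar>b k \<mu> * mi_power z \<mu>\<bar>) has_sum (\<Prod>k\<in>UNIV. (w' $ k) ^ (j $ k))) (LL j)"
      unfolding LL by (rule has_sum_prod_PiE) (auto intro: has_sum_lists_length B)
    from has_sum_cmult_right[OF this, of "\<bar>a j\<bar>"]
    have "((\<lambda>L. \<bar>f L\<bar>) has_sum \<bar>a j\<bar> * mi_power w' j) (LL j)"
      unfolding mi_power_def[of w']
      by (rule has_sum_cong[THEN iffD1, rotated]) (simp add: f_def len abs_mult abs_prod abs_list)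
    then show ?thesis using mi_power_nonneg[of w' j] w' by (simp add: abs_mult)
  qed
  \<comment> \<open>Convergence of the outer series at w' is what makes the whole family absolutely
    summable and permits the regrouping.\<close>
  have "(\<lambda>(j, L). \<bar>f L\<bar>) summable_on Sigma UNIV LL"
    by (rule summable_on_SigmaI[where g = "\<lambda>j. \<bar>a j * mi_power w' j\<bar>"])
      (use f_abs F' summable_on_iff_abs_summable_on_real[of "\<lambda>j. a j * mi_power w' j"] in auto)
  then have "(\<lambda>(j, L). f L) summable_on Sigma UNIV LL"
    by (subst summable_on_iff_abs_summable_on_real) (simp add: case_prod_unfold)
  then have 1: "((\<lambda>(j, L). f L) has_sum F) (Sigma UNIV LL)"
    by (intro has_sum_SigmaI[OF _ F]) (auto intro: f_sum)
  have 2: "(f has_sum F) UNIV"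
    by (subst has_sum_reindex_bij_witness[where j = "\<lambda>L. (\<chi> k. length (L k), L)" and i = snd
          and T = "Sigma UNIV LL" and h = "\<lambda>(j, L). f L" and s' = F])
      (use 1 in \<open>auto simp: LL_def vec_eq_iff\<close>)
  define TT where "TT i = {L :: 'd \<Rightarrow> (nat ^ 'n) list. (\<Sum>k\<in>UNIV. sum_list (L k)) = i}" for i
  have 3: "((\<lambda>(i, L). f L) has_sum F) (Sigma UNIV TT)"
    by (subst has_sum_reindex_bij_witness[where i = "\<lambda>L. (\<Sum>k\<in>UNIV. sum_list (L k), L)" and j = snd
          and T = UNIV and h = f and s' = F])
      (use 2 in \<open>auto simp: TT_def\<close>)
  \<comment> \<open>\<open>TT i\<close> is infinite because zero entries may be inserted at will,
    but families containing them contribute 0 by \<open>b0\<close>.\<close>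
  have "(f has_sum comp_coeff a b i * mi_power z i) (TT i)" for i
  proof (rule has_sum_finite_neutralI[of "decomp_lists i"])
    show "f L = 0" if "L \<in> TT i - decomp_lists i" for L
    proof -
      obtain k where "0 \<in> set (L k)" using \<open>L \<in> _\<close> by (auto simp: TT_def decomp_lists_def)
      then have "(\<Prod>\<mu>\<leftarrow>L k. b k \<mu> * mi_power z \<mu>) = 0"
        by (force simp: prod_list_zero_iff b0)
      then have "(\<Prod>k\<in>UNIV. \<Prod>\<mu>\<leftarrow>L k. b k \<mu> * mi_power z \<mu>) = 0"
        by (intro prod_zero) auto
      then show ?thesis by (simp add: f_def)
    qed
    have list: "(\<Prod>\<mu>\<leftarrow>l. b k \<mu> * mi_power z \<mu>) = (\<Prod>\<mu>\<leftarrow>l. b k \<mu>) * mi_power z (sum_list l)" for k l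
      by (induction l) (simp_all add: mi_power_add)
    show "comp_coeff a b i * mi_power z i = sum f (decomp_lists i)"
      unfolding comp_coeff_def sum_distrib_right
      by (rule sum.cong)
        (auto simp: f_def decomp_lists_def list prod.distrib mi_power_sum)
  qed (auto simp: TT_def decomp_lists_def intro: finite_decomp_lists[unfolded decomp_lists_def])
  with has_sum_SigmaD[OF 3, of "\<lambda>i. comp_coeff a b i * mi_power z i"] show ?thesis
    by simp
qed

text \<open>It remains to choose z so small that both the inner values and their absolute majorants
  \<open>B k\<close> lie in the ball where the outer series converges.\<close>

lemma has_mps_compose:
  fixes a :: "nat ^ 'd \<Rightarrow> real" and b :: "'d::finite \<Rightarrow> nat ^ 'n \<Rightarrow> real"
  assumes F: "has_mps a F" and W: "\<And>k. has_mps (b k) (W k)" and b0: "\<And>k. b k 0 = 0"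
  shows "has_mps (comp_coeff a b) (\<lambda>z. F (\<chi> k. W k z))"
proof -
  obtain r where r: "r > 0" "\<And>w. norm w < r \<Longrightarrow> ((\<lambda>j. a j * mi_power w j) has_sum F w) UNIV"
    using F by (auto simp: has_mps_def)
  \<comment> \<open>A vector with all coordinates at most e in modulus has norm at most r/2.\<close>
  define e where "e = r / (2 * CARD('d))"
  have e: "e > 0" using r(1) by (simp add: e_def)
  have small: "norm w < r" if "\<And>k. \<bar>w $ k\<bar> \<le> e" for w :: "real ^ 'd"
  proof -
    have "norm w \<le> (\<Sum>p\<in>UNIV. \<bar>w $ p\<bar>)" by (rule norm_le_l1_cart)
    also have "\<dots> \<le> (\<Sum>p\<in>(UNIV :: 'd set). e)" by (rule sum_mono) (use that in auto)
    also have "\<dots> < r" using r(1) by (simp add: e_def)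
    finally show ?thesis .
  qed
  have "\<exists>\<delta>>0. \<forall>z. norm z < \<delta> \<longrightarrow> (\<exists>B\<le>e. ((\<lambda>j. \<bar>b k j * mi_power z j\<bar>) has_sum B) UNIV)" for k
    using has_mps_abs_small[OF W b0 e, of k] by metis
  then obtain \<delta> where \<delta>: "\<And>k. \<delta> k > 0"
    "\<And>k z. norm z < \<delta> k \<Longrightarrow> \<exists>B\<le>e. ((\<lambda>j. \<bar>b k j * mi_power z j\<bar>) has_sum B) UNIV"
    by metis
  obtain \<delta>' where \<delta>': "\<And>k. \<delta>' k > 0"
    "\<And>k z. norm z < \<delta>' k \<Longrightarrow> ((\<lambda>j. b k j * mi_power z j) has_sum W k z) UNIV"
    using W unfolding has_mps_def by metis
  define \<eta> where "\<eta> = Min (range (\<lambda>k. min (\<delta> k) (\<delta>' k)))"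
  have \<eta>: "\<eta> > 0" "\<eta> \<le> \<delta> k" "\<eta> \<le> \<delta>' k" for k
  proof -
    show "\<eta> > 0" unfolding \<eta>_def using \<delta> \<delta>' by (subst Min_gr_iff) auto
    have "\<eta> \<le> min (\<delta> k) (\<delta>' k)" unfolding \<eta>_def by (rule Min_le) auto
    then show "\<eta> \<le> \<delta> k" "\<eta> \<le> \<delta>' k" by auto
  qed
  show ?thesis unfolding has_mps_def
  proof (intro exI[of _ \<eta>] conjI allI impI)
    fix z :: "real ^ 'n" assume z: "norm z < \<eta>"
    have "\<forall>k. \<exists>B\<le>e. ((\<lambda>j. \<bar>b k j * mi_power z j\<bar>) has_sum B) UNIV"
      using \<delta>(2) z \<eta>(2) by (meson less_le_trans)
    then obtain B where B: "\<And>k. B k \<le> e" "\<And>k. ((\<lambda>j. \<bar>b k j * mi_power z j\<bar>) has_sum B k) UNIV"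
      by metis
    have W: "((\<lambda>j. b k j * mi_power z j) has_sum W k z) UNIV" for k
      using \<delta>'(2) z \<eta>(3) by (meson less_le_trans)
    have WB: "\<bar>W k z\<bar> \<le> B k" for k
      using norm_has_sum_bound[OF _ W[of k]] B(2)[of k] by simp
    show "((\<lambda>i. comp_coeff a b i * mi_power z i) has_sum F (\<chi> k. W k z)) UNIV"
    proof (rule has_sum_compose_pointwise[where w = "\<chi> k. W k z" and w' = "\<chi> k. B k"])
      show "((\<lambda>j. a j * mi_power (\<chi> k. W k z) j) has_sum F (\<chi> k. W k z)) UNIV"
        by (rule r(2)[OF small]) (use WB B(1) order_trans in fastforce)
      have "0 \<le> B k" for k using WB[of k] by linarith
      then show "(\<lambda>j. a j * mi_power (\<chi> k. B k) j) summable_on UNIV"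
        by (intro has_sum_imp_summable[OF r(2)[OF small]]) (use B(1) in simp)
    qed (use W B b0 in auto)
  qed (rule \<eta>)
qed

section \<open>Powers of linear forms\<close>

text \<open>The product over the coordinates of the one-variable exponential series.\<close>

lemma exp_has_sum:
  fixes y :: "real ^ 'n"
  shows "((\<lambda>\<mu>. mi_power y \<mu> / mi_fact \<mu>) has_sum exp (\<Sum>p\<in>UNIV. y $ p)) UNIV"
proof -
  have exp: "((\<lambda>m. (y $ p) ^ m / fact m) has_sum exp (y $ p)) UNIV" for p
  proof (rule norm_summable_imp_has_sum)
    show "summable (\<lambda>m. norm ((y $ p) ^ m / fact m))"
      using summable_norm_exp[of "y $ p"] by (simp add: divide_inverse mult.commute)
    show "(\<lambda>m. (y $ p) ^ m / fact m) sums exp (y $ p)"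
      using exp_converges[of "y $ p"] by (simp add: divide_inverse mult.commute)
  qed
  have "((\<lambda>g. \<Prod>p\<in>UNIV. (y $ p) ^ g p / fact (g p)) has_sum (\<Prod>p\<in>UNIV. exp (y $ p)))
      (PiE UNIV (\<lambda>p :: 'n. UNIV))"
    by (rule has_sum_prod_PiE) (auto intro: exp)
  then show ?thesis
    by (subst has_sum_reindex_bij_witness[where i = vec_lambda and j = "($)" and T = UNIV
          and h = "\<lambda>g. \<Prod>p\<in>UNIV. (y $ p) ^ g p / fact (g p)" and s' = "\<Prod>p\<in>UNIV. exp (y $ p)"])
      (auto simp: mi_power_def mi_fact_def prod_dividef exp_sum)
qed

lemma finite_mi_abs_eq: "finite {\<mu> :: nat ^ 'n. mi_abs \<mu> = m}"
proof (rule finite_subset)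
  show "{\<mu> :: nat ^ 'n. mi_abs \<mu> = m} \<subseteq> {\<mu>. \<forall>p. \<mu> $ p \<le> (\<chi> p. m) $ p}"
    by (auto simp: mi_abs_def intro!: member_le_sum)
qed (rule finite_mi_le)

text \<open>Compare the coefficients of t^m in two expansions of exp (t (y_1 + ... + y_n)): the
  multivariate exponential series grouped by total degree, and the one-variable one.\<close>

lemma multinomial_mi:
  fixes y :: "real ^ 'n"
  shows "(\<Sum>\<mu>\<in>{\<mu>. mi_abs \<mu> = m}. mi_power y \<mu> / mi_fact \<mu>) = (\<Sum>p\<in>UNIV. y $ p) ^ m / fact m"
proof -
  define G where "G m = (\<Sum>\<mu>\<in>{\<mu>. mi_abs \<mu> = m}. mi_power y \<mu> / mi_fact \<mu>)" for m
  let ?s = "\<Sum>p\<in>UNIV. y $ p"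
  have "(\<lambda>m. (G m - ?s ^ m / fact m) * t ^ m) sums 0" for t
  proof -
    have "((\<lambda>(m, \<mu>). mi_power (t *\<^sub>R y) \<mu> / mi_fact \<mu>) has_sum exp (\<Sum>p\<in>UNIV. (t *\<^sub>R y) $ p))
        (Sigma UNIV (\<lambda>m. {\<mu>. mi_abs \<mu> = m}))"
      by (subst has_sum_reindex_bij_witness[where j = snd and i = "\<lambda>\<mu>. (mi_abs \<mu>, \<mu>)" and T = UNIV
            and h = "\<lambda>\<mu>. mi_power (t *\<^sub>R y) \<mu> / mi_fact \<mu>" and s' = "exp (\<Sum>p\<in>UNIV. (t *\<^sub>R y) $ p)"])
        (use exp_has_sum[of "t *\<^sub>R y"] in auto)
    then have "((\<lambda>m. G m * t ^ m) has_sum exp (\<Sum>p\<in>UNIV. (t *\<^sub>R y) $ p)) UNIV"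
    proof (rule has_sum_SigmaD)
      show "((\<lambda>\<mu>. case (m, \<mu>) of (m, \<mu>) \<Rightarrow> mi_power (t *\<^sub>R y) \<mu> / mi_fact \<mu>) has_sum G m * t ^ m) {\<mu>. mi_abs \<mu> = m}" for m
        unfolding G_def sum_distrib_right prod.case
        by (rule has_sum_finiteI[OF finite_mi_abs_eq]) (auto simp: mi_power_scaleR intro!: sum.cong)
    qed
    then have "(\<lambda>m. G m * t ^ m) sums exp (?s * t)"
      by (intro has_sum_imp_sums) (simp add: mult.commute flip: sum_distrib_left)
    moreover have "(\<lambda>m. ?s ^ m / fact m * t ^ m) sums exp (?s * t)"
      using exp_converges[of "?s * t"] by (simp add: power_mult_distrib divide_inverse mult_ac)
    ultimately have "(\<lambda>m. G m * t ^ m - ?s ^ m / fact m * t ^ m) sums (exp (?s * t) - exp (?s * t))"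
      by (rule sums_diff)
    then show ?thesis by (simp add: left_diff_distrib)
  qed
  then have "G m - ?s ^ m / fact m = 0"
    by (intro powser_zero_coeffs[of 1]) auto
  then show ?thesis by (simp add: G_def)
qed

text \<open>The multinomial theorem expands each power of v . z, and regrouping by total degree is
  justified by applying it also to the absolute values |v_p z_p|, whose sum stays below r.\<close>

lemma has_mps_linear_form:
  fixes v :: "real ^ 'n"
  assumes "r > 0" and c: "\<And>u. \<bar>u\<bar> < r \<Longrightarrow> (\<lambda>m. c m * (u ^ m / fact m)) sums f u"
  shows "has_mps (\<lambda>\<mu>. c (mi_abs \<mu>) * mi_power v \<mu> / mi_fact \<mu>) (\<lambda>z. f (v \<bullet> z))"
proof -
  \<comment> \<open>The summand 1 keeps K positive when v = 0.\<close>
  define K where "K = (\<Sum>p\<in>UNIV. \<bar>v $ p\<bar>) + 1"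
  have K: "K > 0" unfolding K_def by (intro add_nonneg_pos sum_nonneg) auto
  \<comment> \<open>\<open>sums\<close> only gives convergence in order; convergence at a larger
    radius u' makes it absolute at u.\<close>
  have abs_summ: "(\<lambda>m. \<bar>c m * (u ^ m / fact m)\<bar>) summable_on UNIV" if u: "\<bar>u\<bar> < r" for u
  proof -
    obtain u' where u': "\<bar>u\<bar> < u'" "u' < r" using dense[OF u] by auto
    have "summable (\<lambda>m. (c m / fact m) * u' ^ m)"
      using sums_summable[OF c[of u']] u' by simp
    from powser_insidea[OF this, of u] u' have "summable (\<lambda>m. \<bar>c m * (u ^ m / fact m)\<bar>)"
      by simp
    then show ?thesis by (simp add: summable_on_UNIV_nonneg_real_iff)
  qed
  have absc: "\<bar>c m\<bar> * (u ^ m / fact m) = \<bar>c m * (u ^ m / fact m)\<bar>" if "0 \<le> u" for u m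
    using that by (simp add: abs_mult)
  show ?thesis unfolding has_mps_def
  proof (intro exI[of _ "r / K"] conjI allI impI)
    fix z :: "real ^ 'n" assume z: "norm z < r / K"
    define y :: "real ^ 'n" where "y = (\<chi> p. v $ p * z $ p)"
    have y: "mi_power y \<mu> = mi_power v \<mu> * mi_power z \<mu>" for \<mu>
      by (simp add: y_def mi_power_def power_mult_distrib prod.distrib)
    let ?s = "\<Sum>p\<in>UNIV. y $ p" and ?a = "\<Sum>p\<in>UNIV. \<bar>y $ p\<bar>"
    have s: "?s = v \<bullet> z" by (simp add: y_def inner_vec_def)
    have "?a \<le> (\<Sum>p\<in>UNIV. \<bar>v $ p\<bar> * norm z)"
      by (intro sum_mono) (simp add: y_def abs_mult component_le_norm_cart mult_left_mono)
    also have "\<dots> = (\<Sum>p\<in>UNIV. \<bar>v $ p\<bar>) * norm z" by (rule sum_distrib_right[symmetric])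
    also have "\<dots> \<le> K * norm z" by (rule mult_right_mono) (auto simp: K_def)
    also have "\<dots> < r" using z K by (simp add: field_simps)
    finally have a: "?a < r" .
    have a0: "0 \<le> ?a" by (rule sum_nonneg) simp
    have s': "\<bar>?s\<bar> < r" by (rule le_less_trans[OF sum_abs a])
    let ?I = "Sigma UNIV (\<lambda>m. {\<mu> :: nat ^ 'n. mi_abs \<mu> = m})"
    have "(\<lambda>(m, \<mu>). \<bar>c m * (mi_power y \<mu> / mi_fact \<mu>)\<bar>) summable_on ?I"
    proof (rule summable_on_SigmaI)
      fix m
      have "(\<Sum>\<mu>\<in>{\<mu>. mi_abs \<mu> = m}. \<bar>c m * (mi_power y \<mu> / mi_fact \<mu>)\<bar>) =
          \<bar>c m\<bar> * (\<Sum>\<mu>\<in>{\<mu>. mi_abs \<mu> = m}. mi_power (\<chi> p. \<bar>y $ p\<bar>) \<mu> / mi_fact \<mu>)"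
        unfolding sum_distrib_left
        by (rule sum.cong) (simp_all add: abs_mult abs_mi_power less_imp_le mi_fact_pos)
      also have "\<dots> = \<bar>c m * (?a ^ m / fact m)\<bar>"
        unfolding multinomial_mi vec_lambda_beta by (rule absc[OF a0])
      finally show "((\<lambda>\<mu>. case (m, \<mu>) of (m, \<mu>) \<Rightarrow> \<bar>c m * (mi_power y \<mu> / mi_fact \<mu>)\<bar>) has_sum
          \<bar>c m * (?a ^ m / fact m)\<bar>) {\<mu>. mi_abs \<mu> = m}"
        unfolding prod.case by (intro has_sum_finiteI finite_mi_abs_eq) (rule sym)
    qed (use abs_summ[of ?a] a a0 in auto)
    then have summ: "(\<lambda>(m, \<mu>). c m * (mi_power y \<mu> / mi_fact \<mu>)) summable_on ?I"
      by (subst summable_on_iff_abs_summable_on_real) (simp add: case_prod_unfold)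
    have lin: "((\<lambda>\<mu>. c m * (mi_power y \<mu> / mi_fact \<mu>)) has_sum c m * (?s ^ m / fact m)) {\<mu>. mi_abs \<mu> = m}" for m
      by (intro has_sum_cmult_right has_sum_finiteI finite_mi_abs_eq multinomial_mi[symmetric])
    have outer: "((\<lambda>m. c m * (?s ^ m / fact m)) has_sum f ?s) UNIV"
      by (rule norm_summable_imp_has_sum)
        (use abs_summ[OF s'] c[OF s'] in \<open>auto simp: summable_on_UNIV_nonneg_real_iff\<close>)
    have 1: "((\<lambda>(m, \<mu>). c m * (mi_power y \<mu> / mi_fact \<mu>)) has_sum f ?s) ?I"
      by (rule has_sum_SigmaI[OF _ outer summ]) (unfold prod.case, rule lin)
    have "bij_betw (\<lambda>\<mu>. (mi_abs \<mu>, \<mu>)) UNIV ?I"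
      by (rule bij_betwI[where g = snd]) auto
    from has_sum_reindex_bij_betw[OF this, THEN iffD2, OF 1]
    show "((\<lambda>\<mu>. c (mi_abs \<mu>) * mi_power v \<mu> / mi_fact \<mu> * mi_power z \<mu>) has_sum f (v \<bullet> z)) UNIV"
      unfolding s by (simp add: y mult.assoc)
  qed (use K assms(1) in auto)
qed

section \<open>Lists of multi-indices and multi-index partitions\<close>

text \<open>Two distinct columns differ in finitely many rows, so they are comparable
  lexicographically. Interpreting \<open>linorder\<close> locally then provides sorting and its
  uniqueness.\<close>

lemma
  fixes l :: "(nat ^ 'n::{finite,linorder}) list"
  shows ex_sorted_mi_lex: "\<exists>l'. mset l' = mset l \<and> sorted_wrt mi_lex_le l'"
    and sorted_mi_lex_unique: "sorted_wrt mi_lex_le l \<Longrightarrow> sorted_wrt mi_lex_le l' \<Longrightarrow> mset l' = mset l \<Longrightarrow> l' = l"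
proof -
  have "class.linorder mi_lex_le (\<lambda>x y :: nat ^ 'n::{finite,linorder}. less_fun (($) x) (($) y))"
  proof
    fix x y z :: "nat ^ 'n::{finite,linorder}"
    have inj: "x = y" if "($) x = ($) y"
      using that by (simp add: vec_nth_inject)
    show "less_fun (($) x) (($) y) = (mi_lex_le x y \<and> \<not> mi_lex_le y x)"
      using less_fun_asym less_fun_irrefl by (auto simp: mi_lex_le_def)
    show "mi_lex_le x x" by (simp add: mi_lex_le_def)
    show "mi_lex_le x y \<Longrightarrow> mi_lex_le y z \<Longrightarrow> mi_lex_le x z"
      using less_fun_trans by (auto simp: mi_lex_le_def)
    show "mi_lex_le x y \<Longrightarrow> mi_lex_le y x \<Longrightarrow> x = y"
      using less_fun_asym by (auto simp: mi_lex_le_def)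
    show "mi_lex_le x y \<or> mi_lex_le y x"
      using less_fun_trichotomy[of "($) x" "($) y"] inj by (auto simp: mi_lex_le_def)
  qed
  then interpret mi: linorder mi_lex_le "\<lambda>x y :: nat ^ 'n::{finite,linorder}. less_fun (($) x) (($) y)" .
  show "\<exists>l'. mset l' = mset l \<and> sorted_wrt mi_lex_le l'"
    by (rule exI[of _ "mi.sort l"]) simp
  show "sorted_wrt mi_lex_le l \<Longrightarrow> sorted_wrt mi_lex_le l' \<Longrightarrow> mset l' = mset l \<Longrightarrow> l' = l"
    by (metis mi.properties_for_sort)
qed

lemma mi_partitions_iff:
  "l \<in> mi_partitions s \<longleftrightarrow> 0 \<notin> set l \<and> sorted_wrt mi_lex_le l \<and> sum_list l = s"
  by (auto simp: mi_partitions_def vec_eq_iff sum_list_component)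

lemma prod_list_eq_part_prod:
  "(\<Prod>\<mu>\<leftarrow>l. (g :: nat ^ 'n \<Rightarrow> real) \<mu> / mi_fact \<mu>) = part_prod g l / part_fact l"
proof -
  have "(\<Prod>\<mu>\<leftarrow>l. g \<mu> / mi_fact \<mu>) = (\<Prod>\<mu>\<in>set l. (g \<mu> / mi_fact \<mu>) ^ count_list l \<mu>)"
    using image_prod_mset_multiplicity[of "\<lambda>\<mu>. g \<mu> / mi_fact \<mu>" "mset l"]
    by (simp add: count_mset flip: prod_mset_prod_list)
  then show ?thesis
    by (simp add: part_prod_def part_fact_def power_divide prod_dividef)
qed

text \<open>A multinomial coefficient counts the distinct arrangements. It is divided by the
  factorial of the length because that factorial occurs in the normalisation of the outer
  coefficient.\<close>

lemma card_permutations_eq: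
  "real (card (permutations_of_multiset (mset l))) / fact (length l) = 1 / mult_fact l"
proof -
  have "real (card (permutations_of_multiset (mset l)) * (\<Prod>x\<in>set_mset (mset l). fact (count (mset l) x))) =
      real (fact (size (mset l)))"
    by (subst card_permutations_of_multiset_aux) (rule refl)
  then have "real (card (permutations_of_multiset (mset l))) * mult_fact l = fact (length l)"
    by (simp add: mult_fact_def count_mset)
  moreover have "mult_fact l > 0" unfolding mult_fact_def by (rule prod_pos) simp
  ultimately show ?thesis by (simp add: field_simps)
qed

lemma umbral_eval_0 [simp]: "umbral_eval c 0 = 0"
  by (simp add: umbral_eval_def)

lemma umbral_eval_sum: "umbral_eval c (sum f S) = (\<Sum>x\<in>S. umbral_eval c (f x))"
  by (induction S rule: infinite_finite_induct) (simp_all add: umbral_eval_add)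

lemma umbral_eval_gen_bell:
  fixes c :: "nat ^ 'd::finite \<Rightarrow> real" and i :: "nat ^ 'n::{finite,linorder}"
  shows "umbral_eval c (gen_bell g i indet) = mi_fact i *
     (\<Sum>s\<in>{s. (\<Sum>k\<in>UNIV. s k) = i}. \<Sum>\<Lambda>\<in>PiE UNIV (\<lambda>k. mi_partitions (s k)).
        c (\<chi> k. length (\<Lambda> k)) * ((\<Prod>k\<in>UNIV. part_prod (g k) (\<Lambda> k)) /
            ((\<Prod>k\<in>UNIV. part_fact (\<Lambda> k)) * (\<Prod>k\<in>UNIV. mult_fact (\<Lambda> k)))))"
proof -
  have "umbral_eval c ((\<Prod>k\<in>UNIV. indet k ^ length (\<Lambda> k)) * mconst q) = c (\<chi> k. length (\<Lambda> k)) * q" for \<Lambda> :: "'d \<Rightarrow> (nat ^ 'n::{finite,linorder}) list" and q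
    using umbral_eval_monomial[of c "\<chi> k. length (\<Lambda> k)"]
    by (simp add: mult.commute[of _ "mconst q"] umbral_eval_scale)
  then show ?thesis
    by (simp add: gen_bell_def umbral_eval_scale umbral_eval_sum)
qed

text \<open>Exactly \<open>\<Prod>k. length (\<Lambda> k)! / mult_fact (\<Lambda> k)\<close> families of lists sort to the family \<open>\<Lambda>\<close>;
  the numerator cancels the factorial of the outer exponent.\<close>

lemma comp_coeff_eq_umbral_eval:
  fixes c :: "nat ^ 'd::finite \<Rightarrow> real" and g :: "'d \<Rightarrow> nat ^ 'n::{finite,linorder} \<Rightarrow> real"
  shows "mi_fact i * comp_coeff (\<lambda>j. c j / mi_fact j) (\<lambda>k \<mu>. g k \<mu> / mi_fact \<mu>) i =
    umbral_eval c (gen_bell g i indet)"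
proof -
  \<comment> \<open>Only existence and uniqueness of the sorted rearrangement matter, so any choice
    function will do.\<close>
  obtain srt :: "(nat ^ 'n::{finite,linorder}) list \<Rightarrow> (nat ^ 'n::{finite,linorder}) list"
    where srt: "\<And>l. mset (srt l) = mset l" "\<And>l. sorted_wrt mi_lex_le (srt l)"
    using ex_sorted_mi_lex by metis
  have srt_set: "set (srt l) = set l" for l using srt(1) by (metis set_mset_mset)
  have srt_sum: "sum_list (srt l) = sum_list l" for l using srt(1) by (metis sum_mset_sum_list)
  have srt_eq: "srt l = l'" if "mset l' = mset l" "sorted_wrt mi_lex_le l'" for l l'
    using that srt sorted_mi_lex_unique by metis
  \<comment> \<open>The multi-indices s_k are left out: they are recovered as the column sums
    \<open>sum_list (\<Lambda> k)\<close>, which later restores the double sum of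
    \<open>gen_bell\<close>.\<close>
  define DP where "DP = {\<Lambda> :: 'd \<Rightarrow> (nat ^ 'n::{finite,linorder}) list.
    (\<forall>k. 0 \<notin> set (\<Lambda> k) \<and> sorted_wrt mi_lex_le (\<Lambda> k)) \<and> (\<Sum>k\<in>UNIV. sum_list (\<Lambda> k)) = i}"
  let ?f = "\<lambda>L. c (\<chi> k. length (L k)) / mi_fact (\<chi> k. length (L k)) *
      (\<Prod>k\<in>UNIV. \<Prod>\<mu>\<leftarrow>L k. g k \<mu> / mi_fact \<mu>)"
  let ?h = "\<lambda>\<Lambda>. c (\<chi> k. length (\<Lambda> k)) * ((\<Prod>k\<in>UNIV. part_prod (g k) (\<Lambda> k)) /
            ((\<Prod>k\<in>UNIV. part_fact (\<Lambda> k)) * (\<Prod>k\<in>UNIV. mult_fact (\<Lambda> k))))"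
  have "DP \<subseteq> decomp_lists i" by (auto simp: DP_def decomp_lists_def)
  then have fin: "finite DP" using finite_decomp_lists finite_subset by blast
  \<comment> \<open>Permuting a list changes neither its sum nor its entries, so the lists of a
    family can be permuted independently of one another.\<close>
  have fib: "{L \<in> decomp_lists i. srt \<circ> L = \<Lambda>} = PiE UNIV (\<lambda>k. permutations_of_multiset (mset (\<Lambda> k)))"
    if "\<Lambda> \<in> DP" for \<Lambda>
  proof (intro equalityI subsetI)
    fix L assume "L \<in> {L \<in> decomp_lists i. srt \<circ> L = \<Lambda>}"
    then show "L \<in> PiE UNIV (\<lambda>k. permutations_of_multiset (mset (\<Lambda> k)))"
      using srt(1) by (auto simp: permutations_of_multiset_def)
  next
    fix L assume "L \<in> PiE UNIV (\<lambda>k. permutations_of_multiset (mset (\<Lambda> k)))"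
    then have m: "mset (\<Lambda> k) = mset (L k)" for k
      using PiE_mem[of L UNIV "\<lambda>k. permutations_of_multiset (mset (\<Lambda> k))" k]
      by (simp add: permutations_of_multiset_def)
    have "sum_list (L k) = sum_list (\<Lambda> k)" for k
      using m[of k] by (metis sum_mset_sum_list)
    moreover have "set (L k) = set (\<Lambda> k)" for k
      using mset_eq_setD[OF m[of k]] by simp
    moreover have "srt (L k) = \<Lambda> k" for k
      using srt_eq[OF m[of k]] that by (auto simp: DP_def)
    ultimately show "L \<in> {L \<in> decomp_lists i. srt \<circ> L = \<Lambda>}"
      using that by (auto simp: DP_def decomp_lists_def)
  qed
  have inner: "(\<Sum>L\<in>{L \<in> decomp_lists i. srt \<circ> L = \<Lambda>}. ?f L) = ?h \<Lambda>" if "\<Lambda> \<in> DP" for \<Lambda>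
  proof -
    have "?f L = ?f \<Lambda>" if "L \<in> PiE UNIV (\<lambda>k. permutations_of_multiset (mset (\<Lambda> k)))" for L
    proof -
      have m: "mset (L k) = mset (\<Lambda> k)" for k using that by (auto simp: PiE_def permutations_of_multiset_def)
      have "length (L k) = length (\<Lambda> k)" for k using m[of k] by (metis size_mset)
      moreover have "(\<Prod>\<mu>\<leftarrow>L k. g k \<mu> / mi_fact \<mu>) = (\<Prod>\<mu>\<leftarrow>\<Lambda> k. g k \<mu> / mi_fact \<mu>)" for k
        using m[of k] by (simp flip: prod_mset_prod_list)
      ultimately show ?thesis by simp
    qed
    then have "(\<Sum>L\<in>{L \<in> decomp_lists i. srt \<circ> L = \<Lambda>}. ?f L) =
        real (card (PiE UNIV (\<lambda>k. permutations_of_multiset (mset (\<Lambda> k))))) * ?f \<Lambda>"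
      unfolding fib[OF that] by (simp add: sum_constant)
    also have "real (card (PiE UNIV (\<lambda>k. permutations_of_multiset (mset (\<Lambda> k))))) =
        (\<Prod>k\<in>UNIV. real (card (permutations_of_multiset (mset (\<Lambda> k)))))"
      by (simp add: card_PiE)
    also have "\<dots> * ?f \<Lambda> = c (\<chi> k. length (\<Lambda> k)) *
        (\<Prod>k\<in>UNIV. real (card (permutations_of_multiset (mset (\<Lambda> k)))) / fact (length (\<Lambda> k))) *
        (\<Prod>k\<in>UNIV. part_prod (g k) (\<Lambda> k) / part_fact (\<Lambda> k))"
      unfolding prod_list_eq_part_prod mi_fact_def[of "\<chi> k. length (\<Lambda> k)"]
      by (simp add: prod_dividef)
    also have "\<dots> = ?h \<Lambda>"
      by (simp add: card_permutations_eq prod_dividef)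
    finally show ?thesis .
  qed
  have "comp_coeff (\<lambda>j. c j / mi_fact j) (\<lambda>k \<mu>. g k \<mu> / mi_fact \<mu>) i = (\<Sum>L\<in>decomp_lists i. ?f L)"
    by (simp add: comp_coeff_def)
  also have "\<dots> = (\<Sum>\<Lambda>\<in>DP. \<Sum>L\<in>{L \<in> decomp_lists i. srt \<circ> L = \<Lambda>}. ?f L)"
    by (rule sum.group[symmetric])
      (auto simp: finite_decomp_lists fin, auto simp: DP_def decomp_lists_def srt srt_set srt_sum)
  also have "\<dots> = (\<Sum>\<Lambda>\<in>DP. ?h \<Lambda>)"
    by (rule sum.cong) (use inner in auto)
  also have "\<dots> = (\<Sum>(s, \<Lambda>)\<in>Sigma {s. (\<Sum>k\<in>UNIV. s k) = i} (\<lambda>s. PiE UNIV (\<lambda>k. mi_partitions (s k))). ?h \<Lambda>)"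
    by (rule sum.reindex_bij_witness[where i = snd and j = "\<lambda>\<Lambda>. (\<lambda>k. sum_list (\<Lambda> k), \<Lambda>)"])
      (auto simp: DP_def mi_partitions_iff PiE_def Pi_iff)
  also have "\<dots> = (\<Sum>s\<in>{s. (\<Sum>k\<in>UNIV. s k) = i}. \<Sum>\<Lambda>\<in>PiE UNIV (\<lambda>k. mi_partitions (s k)). ?h \<Lambda>)"
    by (rule sum.Sigma[symmetric]) (auto simp: finite_decompositions intro!: finite_PiE finite_mi_partitions)
  finally show ?thesis by (simp add: umbral_eval_gen_bell)
qed

section \<open>Existence and uniqueness of cumulants\<close>

text \<open>Sign changes keep z in the ball where its exponential moment is finite.\<close>

lemma norm_sign_flip:
  fixes z :: "real ^ 'm"
  assumes "\<And>p. \<sigma> p \<in> {1, - 1}"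
  shows "norm (\<chi> p. \<sigma> p * z $ p) = norm z"
proof -
  have "norm (\<sigma> p * z $ p) = norm (z $ p)" for p using assms[of p] by auto
  then show ?thesis by (simp add: norm_vec_def)
qed

text \<open>Multiply the bounds exp |y| \<le> exp y + exp (-y) and expand. Finite exponential
  moments at all sign changes of z thereby give one integrable majorant for all monomials.\<close>

lemma exp_sum_abs_le:
  fixes y :: "'m::finite \<Rightarrow> real"
  shows "exp (\<Sum>p\<in>UNIV. \<bar>y p\<bar>) \<le> (\<Sum>\<sigma>\<in>PiE UNIV (\<lambda>_. {1, - 1}). exp (\<Sum>p\<in>UNIV. \<sigma> p * y p))"
proof -
  have "exp (\<Sum>p\<in>UNIV. \<bar>y p\<bar>) = (\<Prod>p\<in>UNIV. exp \<bar>y p\<bar>)" by (simp add: exp_sum)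
  also have "\<dots> \<le> (\<Prod>p\<in>UNIV. \<Sum>s\<in>{1, - 1}. exp (s * y p))"
  proof (rule prod_mono)
    fix p show "0 \<le> exp \<bar>y p\<bar> \<and> exp \<bar>y p\<bar> \<le> (\<Sum>s\<in>{1, - 1}. exp (s * y p))"
      by (cases "0 \<le> y p") (auto simp: abs_if)
  qed
  also have "\<dots> = (\<Sum>\<sigma>\<in>PiE UNIV (\<lambda>_. {1, - 1}). \<Prod>p\<in>UNIV. exp (\<sigma> p * y p))"
    by (rule prod_sum_PiE) auto
  finally show ?thesis by (simp add: exp_sum)
qed

text \<open>Turns an unconditional sum into the limit of a sequence, the form in which dominated
  convergence applies.\<close>

lemma filterlim_mi_boxes:
  "filterlim (\<lambda>N. {j :: nat ^ 'm. \<forall>p. j $ p \<le> N}) (finite_subsets_at_top UNIV) sequentially"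
  unfolding filterlim_iff eventually_finite_subsets_at_top
proof safe
  fix P and X :: "(nat ^ 'm) set"
  assume X: "finite X" and P: "\<forall>Y. finite Y \<and> X \<subseteq> Y \<and> Y \<subseteq> UNIV \<longrightarrow> P Y"
  have "P {j. \<forall>p. j $ p \<le> N}" if N: "N \<ge> (\<Sum>j\<in>X. mi_abs j)" for N
  proof -
    have "finite {j :: nat ^ 'm. \<forall>p. j $ p \<le> N}" using finite_mi_le[of "\<chi> p. N"] by simp
    moreover have "j $ p \<le> N" if "j \<in> X" for j p
    proof -
      have "j $ p \<le> mi_abs j" unfolding mi_abs_def by (rule member_le_sum) auto
      also have "\<dots> \<le> (\<Sum>j\<in>X. mi_abs j)" by (rule member_le_sum) (use that X in auto)
      finally show ?thesis using N by simp
    qed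
    ultimately show ?thesis using P by blast
  qed
  then show "\<forall>\<^sub>F N in sequentially. P {j. \<forall>p. j $ p \<le> N}"
    by (rule eventually_sequentiallyI)
qed

text \<open>Termwise integration of the exponential series, dominated by \<open>E\<close> = exp
  (\<Sum>p. |z_p X_p|).\<close>

lemma has_mps_mgf:
  fixes X :: "'a \<Rightarrow> real ^ 'm"
  assumes [measurable]: "X \<in> borel_measurable M" and "mgf_finite_near_0 M X"
  shows "has_mps (\<lambda>j. (\<integral>\<omega>. mi_power (X \<omega>) j \<partial>M) / mi_fact j) (mgf M X)"
proof -
  obtain \<epsilon> where \<epsilon>: "\<epsilon> > 0" "\<And>z. norm z < \<epsilon> \<Longrightarrow> integrable M (\<lambda>\<omega>. exp (z \<bullet> X \<omega>))"
    using assms(2) by (auto simp: mgf_finite_near_0_def)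
  show ?thesis unfolding has_mps_def
  proof (intro exI[of _ \<epsilon>] conjI allI impI \<epsilon>(1))
    fix z :: "real ^ 'm" assume z: "norm z < \<epsilon>"
    define y where "y \<omega> = (\<chi> p. z $ p * X \<omega> $ p)" for \<omega>
    define E where "E \<omega> = exp (\<Sum>p\<in>UNIV. \<bar>y \<omega> $ p\<bar>)" for \<omega>
    have [measurable]: "(\<lambda>\<omega>. y \<omega> $ p) \<in> borel_measurable M" for p
      unfolding y_def using measurable_compose[OF assms(1) borel_measurable_nth[of p]] by simp
    have [measurable]: "(\<lambda>\<omega>. mi_power (y \<omega>) j) \<in> borel_measurable M" for j
      by (simp add: mi_power_def)
    have [measurable]: "E \<in> borel_measurable M" unfolding E_def[abs_def] by measurable
    have yz: "(\<Sum>p\<in>UNIV. y \<omega> $ p) = z \<bullet> X \<omega>" for \<omega> by (simp add: y_def inner_vec_def)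
    have E: "integrable M E"
    proof (rule Bochner_Integration.integrable_bound)
      show "integrable M (\<lambda>\<omega>. \<Sum>\<sigma>\<in>PiE UNIV (\<lambda>_. {1, - 1}). exp ((\<chi> p. \<sigma> p * z $ p) \<bullet> X \<omega>))"
        by (intro Bochner_Integration.integrable_sum \<epsilon>(2)) (use z in \<open>auto simp: norm_sign_flip PiE_def Pi_iff\<close>)
      show "AE \<omega> in M. norm (E \<omega>) \<le> norm (\<Sum>\<sigma>\<in>PiE UNIV (\<lambda>_. {1, - 1}). exp ((\<chi> p. \<sigma> p * z $ p) \<bullet> X \<omega>))"
      proof (rule AE_I2)
        fix \<omega>
        have "E \<omega> \<le> (\<Sum>\<sigma>\<in>PiE UNIV (\<lambda>_. {1, - 1}). exp (\<Sum>p\<in>UNIV. \<sigma> p * y \<omega> $ p))"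
          unfolding E_def by (rule exp_sum_abs_le)
        also have "\<dots> = (\<Sum>\<sigma>\<in>PiE UNIV (\<lambda>_. {1, - 1}). exp ((\<chi> p. \<sigma> p * z $ p) \<bullet> X \<omega>))"
          by (simp add: y_def inner_vec_def mult.assoc)
        finally show "norm (E \<omega>) \<le> norm (\<Sum>\<sigma>\<in>PiE UNIV (\<lambda>_. {1, - 1}). exp ((\<chi> p. \<sigma> p * z $ p) \<bullet> X \<omega>))"
          by (simp add: E_def)
      qed
    qed measurable
    have sum_le: "(\<Sum>j\<in>F. \<bar>mi_power (y \<omega>) j / mi_fact j\<bar>) \<le> E \<omega>" if "finite F" for F \<omega>
    proof -
      have "((\<lambda>j. \<bar>mi_power (y \<omega>) j / mi_fact j\<bar>) has_sum E \<omega>) UNIV"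
        using exp_has_sum[of "\<chi> p. \<bar>y \<omega> $ p\<bar>"]
        by (simp add: E_def abs_mi_power abs_of_pos[OF mi_fact_pos])
      from finite_sum_le_has_sum[OF this that] show ?thesis by simp
    qed
    have int: "integrable M (\<lambda>\<omega>. mi_power (y \<omega>) j / mi_fact j)" for j
      by (rule Bochner_Integration.integrable_bound[OF E])
        (use sum_le[of "{j}"] in \<open>auto intro!: AE_I2 simp: E_def\<close>)
    define c where "c j = (\<integral>\<omega>. mi_power (X \<omega>) j \<partial>M) / mi_fact j * mi_power z j" for j
    have c: "c j = (\<integral>\<omega>. mi_power (y \<omega>) j / mi_fact j \<partial>M)" for j
      by (simp add: c_def y_def mi_power_def power_mult_distrib prod.distrib)
    have "(\<Sum>j\<in>F. \<bar>c j\<bar>) \<le> integral\<^sup>L M E" if "finite F" for F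
    proof -
      have "(\<Sum>j\<in>F. \<bar>c j\<bar>) \<le> (\<Sum>j\<in>F. \<integral>\<omega>. \<bar>mi_power (y \<omega>) j / mi_fact j\<bar> \<partial>M)"
        unfolding c by (intro sum_mono integral_abs_bound)
      also have "\<dots> = (\<integral>\<omega>. (\<Sum>j\<in>F. \<bar>mi_power (y \<omega>) j / mi_fact j\<bar>) \<partial>M)"
        by (rule Bochner_Integration.integral_sum[symmetric]) (rule integrable_abs[OF int])
      also have "\<dots> \<le> integral\<^sup>L M E"
        by (intro integral_mono Bochner_Integration.integrable_sum integrable_abs int E sum_le that)
      finally show ?thesis .
    qed
    then have "(\<lambda>j. \<bar>c j\<bar>) summable_on UNIV"
      by (intro nonneg_bdd_above_summable_on bdd_aboveI2) auto
    then have "c summable_on UNIV"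
      by (subst summable_on_iff_abs_summable_on_real) simp
    then have c_sum: "(c has_sum infsum c UNIV) UNIV" by simp
    \<comment> \<open>The series of expectations is already summable, so its value can be identified
      along a single exhausting sequence of finite sets.\<close>
    let ?B = "\<lambda>N. {j :: nat ^ 'm. \<forall>p. j $ p \<le> N}"
    have lim: "(\<lambda>N. sum f (?B N)) \<longlonglongrightarrow> s" if "(f has_sum s) UNIV" for f and s :: real
      using filterlim_compose[OF that[unfolded has_sum_def] filterlim_mi_boxes] .
    have fin: "finite (?B N)" for N using finite_mi_le[of "\<chi> p. N"] by simp
    have "(\<lambda>N. \<integral>\<omega>. (\<Sum>j\<in>?B N. mi_power (y \<omega>) j / mi_fact j) \<partial>M) \<longlonglongrightarrow> (\<integral>\<omega>. exp (z \<bullet> X \<omega>) \<partial>M)"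
    proof (rule integral_dominated_convergence[OF _ _ E])
      show "AE \<omega> in M. (\<lambda>N. \<Sum>j\<in>?B N. mi_power (y \<omega>) j / mi_fact j) \<longlonglongrightarrow> exp (z \<bullet> X \<omega>)"
        by (rule AE_I2) (rule lim[OF exp_has_sum, of "y _", unfolded yz])
      show "AE \<omega> in M. norm (\<Sum>j\<in>?B N. mi_power (y \<omega>) j / mi_fact j) \<le> E \<omega>" for N
        by (rule AE_I2, rule order_trans[OF norm_sum]) (use sum_le[OF fin] in simp)
    qed measurable
    moreover have "(\<integral>\<omega>. (\<Sum>j\<in>?B N. mi_power (y \<omega>) j / mi_fact j) \<partial>M) = sum c (?B N)" for N
      unfolding c by (rule Bochner_Integration.integral_sum) (rule int)
    ultimately have "(\<lambda>N. sum c (?B N)) \<longlonglongrightarrow> mgf M X z" by (simp add: mgf_def)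
    from LIMSEQ_unique[OF this lim[OF c_sum]]
    show "((\<lambda>j. (\<integral>\<omega>. mi_power (X \<omega>) j \<partial>M) / mi_fact j * mi_power z j) has_sum mgf M X z) UNIV"
      unfolding c_def[symmetric] using c_sum by simp
  qed
qed

lemma has_joint_cumulants_iff:
  "has_joint_cumulants M X c \<longleftrightarrow> mgf_finite_near_0 M X \<and> has_mps (\<lambda>j. c j / mi_fact j) (cgf M X)"
  by (simp add: has_joint_cumulants_def has_mps_def)

lemma joint_cumulant_eq:
  assumes "has_joint_cumulants M X c"
  shows "joint_cumulant M X = c"
  unfolding joint_cumulant_def
proof (rule the_equality)
  fix c' assume "has_joint_cumulants M X c'"
  then have "(\<lambda>j. c' j / mi_fact j) = (\<lambda>j. c j / mi_fact j)"
    using assms has_mps_unique by (auto simp: has_joint_cumulants_iff)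
  then have "c' j / mi_fact j = c j / mi_fact j" for j by metis
  then show "c' = c" using mi_fact_pos by (fastforce simp: less_le)
qed (rule assms)

lemma (in prob_space) mgf_0 [simp]: "mgf M X 0 = 1"
  by (simp add: mgf_def prob_space)

text \<open>The logarithmic series is substituted with M - 1, which has no constant term since M(0)
  = 1. Existence of some expansion suffices, as uniqueness identifies it with
  \<open>joint_cumulant\<close>.\<close>

lemma (in prob_space) has_joint_cumulants_joint_cumulant:
  fixes X :: "'a \<Rightarrow> real ^ 'm"
  assumes "X \<in> borel_measurable M" "mgf_finite_near_0 M X"
  shows "has_joint_cumulants M X (joint_cumulant M X)"
proof -
  define b where "b j = (if j = 0 then 0 else (\<integral>\<omega>. mi_power (X \<omega>) j \<partial>M) / mi_fact j)" for j :: "nat ^ 'm"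
  obtain \<epsilon> where \<epsilon>: "\<epsilon> > 0"
    "\<And>z. norm z < \<epsilon> \<Longrightarrow> ((\<lambda>j. (\<integral>\<omega>. mi_power (X \<omega>) j \<partial>M) / mi_fact j * mi_power z j) has_sum mgf M X z) UNIV"
    using has_mps_mgf[OF assms] by (auto simp: has_mps_def)
  have b: "has_mps b (\<lambda>z. mgf M X z - 1)"
    unfolding has_mps_def
  proof (intro exI[of _ \<epsilon>] conjI allI impI \<epsilon>(1))
    fix z :: "real ^ 'm" assume "norm z < \<epsilon>"
    moreover have "((\<lambda>j. if j = 0 then 1 else 0) has_sum (1 :: real)) (UNIV :: (nat ^ 'm) set)"
      by (rule has_sum_finite_neutralI[of "{0}"]) auto
    ultimately have "((\<lambda>j. (\<integral>\<omega>. mi_power (X \<omega>) j \<partial>M) / mi_fact j * mi_power z j + - (if j = 0 then 1 else 0))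
        has_sum mgf M X z + - 1) UNIV"
      by (intro has_sum_add has_sum_uminusI \<epsilon>(2))
    then show "((\<lambda>j. b j * mi_power z j) has_sum mgf M X z - 1) UNIV"
      unfolding diff_conv_add_uminus by (rule has_sum_cong[THEN iffD1, rotated]) (simp_all add: b_def prob_space)
  qed
  define v :: "real ^ 1" where "v = (\<chi> p. 1)"
  \<comment> \<open>The one-variable series of ln (1 + u), written on \<open>real ^ 1\<close> to fit
    the composition result. The factor \<open>fact\<close> cancels the exponential normalisation; in
    degree 0, division by \<open>real 0\<close> yields 0, the correct constant term.\<close>
  have "has_mps (\<lambda>\<mu>. (- fact (mi_abs \<mu>) * (- 1) ^ mi_abs \<mu> / real (mi_abs \<mu>)) * mi_power v \<mu> / mi_fact \<mu>)
      (\<lambda>z. ln (1 + v \<bullet> z))"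
  proof (rule has_mps_linear_form[of 1])
    fix u :: real assume "\<bar>u\<bar> < 1"
    from ln_series'[OF this]
    show "(\<lambda>m. - fact m * (- 1) ^ m / real m * (u ^ m / fact m)) sums ln (1 + u)"
      by (simp add: power_minus[of u])
  qed simp
  from has_mps_compose[OF this, of "\<lambda>_. b" "\<lambda>_ z. mgf M X z - 1"] b
  obtain C where "has_mps C (\<lambda>z. ln (1 + v \<bullet> (\<chi> k. mgf M X z - 1)))"
    by (auto simp: b_def)
  then have "has_mps C (cgf M X)"
    by (simp add: v_def inner_vec_def cgf_def[abs_def])
  moreover have "mi_fact j * C j / mi_fact j = C j" for j using mi_fact_pos[of j] by simp
  ultimately have "has_joint_cumulants M X (\<lambda>j. mi_fact j * C j)"
    using assms(2) by (simp add: has_joint_cumulants_iff)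
  then show ?thesis using joint_cumulant_eq by metis
qed

lemma cumulant_eq:
  assumes "has_cumulants M X c"
  shows "cumulant M X = c"
  unfolding cumulant_def
proof (rule the_equality)
  fix c' assume c': "has_cumulants M X c'"
  obtain e where e: "e > 0" "\<And>u. \<bar>u\<bar> < e \<Longrightarrow> (\<lambda>j. c j * (u ^ j / fact j)) sums cgf M X u"
    using assms by (auto simp: has_cumulants_def)
  obtain e' where e': "e' > 0" "\<And>u. \<bar>u\<bar> < e' \<Longrightarrow> (\<lambda>j. c' j * (u ^ j / fact j)) sums cgf M X u"
    using c' by (auto simp: has_cumulants_def)
  have "c' j / fact j - c j / fact j = 0" for j
  proof (rule powser_zero_coeffs[of "min e e'"])
    fix u :: real assume "\<bar>u\<bar> < min e e'"
    then have "(\<lambda>j. c' j * (u ^ j / fact j) - c j * (u ^ j / fact j)) sums (cgf M X u - cgf M X u)"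
      by (intro sums_diff e(2) e'(2)) auto
    then show "(\<lambda>j. (c' j / fact j - c j / fact j) * u ^ j) sums 0"
      by (simp add: left_diff_distrib)
  qed (use e(1) e'(1) in simp)
  then show "c' = c" by fastforce
qed (rule assms)

text \<open>The scalar case is the vector case on \<open>real ^ 1\<close>, whose multi-indices are
  the natural numbers.\<close>

lemma (in prob_space) has_cumulants_cumulant:
  fixes X :: "'a \<Rightarrow> real"
  assumes [measurable]: "X \<in> borel_measurable M" and fin: "mgf_finite_near_0 M X"
  shows "has_cumulants M X (cumulant M X)"
proof -
  define X' :: "'a \<Rightarrow> real ^ 1" where "X' \<omega> = (\<chi> p. X \<omega>)" for \<omega>
  have X': "X' \<in> borel_measurable M"
    unfolding X'_def
    by (rule measurable_compose[OF assms(1)], intro borel_measurable_continuous_onI continuous_intros)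
  have inner: "z \<bullet> X' \<omega> = (z $ 1) \<bullet> X \<omega>" for z \<omega> by (simp add: X'_def inner_vec_def)
  obtain e where e: "e > 0" "\<And>z. norm z < e \<Longrightarrow> integrable M (\<lambda>\<omega>. exp (z \<bullet> X \<omega>))"
    using fin by (auto simp: mgf_finite_near_0_def)
  have "mgf_finite_near_0 M X'" unfolding mgf_finite_near_0_def inner
    by (rule exI[of _ e], intro conjI allI impI e)
      (use component_le_norm_cart in \<open>auto intro: le_less_trans\<close>)
  with X' obtain c where "has_joint_cumulants M X' c"
    using has_joint_cumulants_joint_cumulant by metis
  then obtain r where r: "r > 0"
    "\<And>z. norm z < r \<Longrightarrow> ((\<lambda>j. c j * (mi_power z j / mi_fact j)) has_sum cgf M X' z) UNIV"
    by (auto simp: has_joint_cumulants_def)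
  have bij: "bij_betw (\<lambda>m. (\<chi> p. m) :: nat ^ 1) UNIV UNIV"
    by (rule bij_betwI[where g = "\<lambda>j. j $ 1"]) (auto simp: vec_eq_iff)
  have "has_cumulants M X (\<lambda>m. c (\<chi> p. m))" unfolding has_cumulants_def
  proof (intro conjI fin exI[of _ r] allI impI r(1))
    fix u :: real assume u: "\<bar>u\<bar> < r"
    have "norm (\<chi> p. u :: real ^ 1) < r"
      using u norm_le_l1_cart[of "\<chi> p. u :: real ^ 1"] by simp
    from has_sum_reindex_bij_betw[OF bij, THEN iffD2, OF r(2)[OF this]]
    have "((\<lambda>m. c (\<chi> p. m) * (u ^ m / fact m)) has_sum cgf M X' (\<chi> p. u)) UNIV"
      by (simp add: mi_power_def mi_fact_def)
    moreover have "cgf M X' (\<chi> p. u) = cgf M X u" by (simp add: cgf_def mgf_def inner)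
    ultimately show "(\<lambda>m. c (\<chi> p. m) * (u ^ m / fact m)) sums cgf M X u"
      by (simp add: has_sum_imp_sums)
  qed
  then show ?thesis using cumulant_eq by metis
qed

text \<open>The value of the series at 0 is ln 1. This supplies the missing constant term that
  substitution into the series of T requires.\<close>

lemma (in prob_space) cumulant_0:
  assumes "X \<in> borel_measurable M" "mgf_finite_near_0 M X"
  shows "cumulant M X 0 = 0"
proof -
  obtain e where "e > 0" "\<And>u. \<bar>u\<bar> < e \<Longrightarrow> (\<lambda>j. cumulant M X j * (u ^ j / fact j)) sums cgf M X u"
    using has_cumulants_cumulant[OF assms] by (auto simp: has_cumulants_def)
  then have "(\<lambda>j. cumulant M X j / fact j * 0 ^ j) sums cgf M X 0" by simp
  then show ?thesis unfolding powser_sums_zero_iff by (simp add: cgf_def)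
qed

section \<open>Exponential moments of a Levy process\<close>

text \<open>A multiple of 1/(n+1) strictly to the right of t. Strictness makes right-continuity
  applicable, and for fixed n only countably many rational values occur.\<close>

definition right_grid :: "nat \<Rightarrow> real \<Rightarrow> real" where
  "right_grid n t = (real (nat \<lfloor>real (Suc n) * t\<rfloor>) + 1) / real (Suc n)"

lemma right_grid_bounds:
  assumes "0 \<le> t"
  shows "t < right_grid n t" "right_grid n t \<le> t + 1 / real (Suc n)"
proof -
  have "0 \<le> real (Suc n) * t" using assms by simp
  then have m: "real (nat \<lfloor>real (Suc n) * t\<rfloor>) = of_int \<lfloor>real (Suc n) * t\<rfloor>"
    by (simp add: of_nat_nat)
  have "real (Suc n) * t < real (nat \<lfloor>real (Suc n) * t\<rfloor>) + 1"
    "real (nat \<lfloor>real (Suc n) * t\<rfloor>) \<le> real (Suc n) * t"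
    unfolding m by linarith+
  then show "t < right_grid n t" "right_grid n t \<le> t + 1 / real (Suc n)"
    by (simp_all add: right_grid_def field_simps del: of_nat_Suc)
qed

lemma filterlim_right_grid:
  assumes "0 \<le> t"
  shows "filterlim (\<lambda>n. right_grid n t) (at_right t) sequentially"
proof -
  have "(\<lambda>n. t + 1 / real (Suc n)) \<longlonglongrightarrow> t + 0"
    by (intro tendsto_add tendsto_const) (use LIMSEQ_inverse_real_of_nat in \<open>simp add: divide_inverse\<close>)
  then have lim: "(\<lambda>n. t + 1 / real (Suc n)) \<longlonglongrightarrow> t" by simp
  have "(\<lambda>n. right_grid n t) \<longlonglongrightarrow> t"
    by (rule tendsto_sandwich[OF _ _ tendsto_const lim])
      (auto intro!: always_eventually less_imp_le right_grid_bounds[OF assms] simp del: of_nat_Suc)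
  moreover have "right_grid n t \<noteq> t" "t < right_grid n t" for n
    using right_grid_bounds(1)[OF assms, of n] by auto
  ultimately show ?thesis by (simp add: filterlim_at)
qed

lemma levy_right_limit:
  assumes "levy_process M X" "\<omega> \<in> space M" "0 \<le> t"
  shows "(\<lambda>n. X (right_grid n t) \<omega>) \<longlonglongrightarrow> X t \<omega>"
proof -
  have "((\<lambda>t. X t \<omega>) \<longlongrightarrow> X t \<omega>) (at_right t)"
    using assms by (auto simp: levy_process_def cadlag_def)
  from filterlim_compose[OF this filterlim_right_grid[OF assms(3)]] show ?thesis .
qed

context prob_space
begin

text \<open>Independence and stationarity of the increments over [0, s] and [s, s + h]. With values
  in \<open>ennreal\<close>, no integrability has to be known beforehand.\<close>

lemma levy_exp_moment_add:
  fixes X :: "real \<Rightarrow> 'a \<Rightarrow> real"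
  assumes X: "levy_process M X" and s: "0 \<le> s" and h: "0 \<le> h"
  shows "(\<integral>\<^sup>+\<omega>. ennreal (exp (u * X (s + h) \<omega>)) \<partial>M) =
    (\<integral>\<^sup>+\<omega>. ennreal (exp (u * X s \<omega>)) \<partial>M) * (\<integral>\<^sup>+\<omega>. ennreal (exp (u * X h \<omega>)) \<partial>M)"
proof -
  have meas: "X t \<in> borel_measurable M" if "0 \<le> t" for t
    using X that by (auto simp: levy_process_def)
  have X0: "AE \<omega> in M. X 0 \<omega> = 0" using X by (auto simp: levy_process_def)
  have \<phi>0: "(\<integral>\<^sup>+\<omega>. ennreal (exp (u * X 0 \<omega>)) \<partial>M) = 1"
  proof -
    have "(\<integral>\<^sup>+\<omega>. ennreal (exp (u * X 0 \<omega>)) \<partial>M) = (\<integral>\<^sup>+\<omega>. 1 \<partial>M)"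
      by (rule nn_integral_cong_AE) (use X0 in auto)
    then show ?thesis by (simp add: emeasure_space_1)
  qed
  \<comment> \<open>Independent increments are available only for strictly increasing times, so
    degenerate intervals are treated apart.\<close>
  consider "s = 0" | "h = 0" | "0 < s" "0 < h" using s h by fastforce
  then show ?thesis
  proof cases
    case 3
    define t :: "nat \<Rightarrow> real" where "t i = (if i = 0 then 0 else if i = 1 then s else s + h)" for i
    have "\<forall>i<2. t i < t (Suc i)" using 3 by (auto simp: t_def less_2_cases_iff)
    moreover have "0 \<le> t 0" by (simp add: t_def)
    ultimately have ind: "indep_vars (\<lambda>_. borel) (\<lambda>i \<omega>. X (t (Suc i)) \<omega> - X (t i) \<omega>) {..<2}"
      using X unfolding levy_process_def by blast
    define D where "D i \<omega> = ennreal (exp (u * (X (t (Suc i)) \<omega> - X (t i) \<omega>)))" for i \<omega>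
    have "indep_vars (\<lambda>_. borel) D {..<2}"
      unfolding D_def using indep_vars_compose2[OF ind, of "\<lambda>_ x. ennreal (exp (u * x))" "\<lambda>_. borel"] by simp
    then have prod: "(\<integral>\<^sup>+\<omega>. (\<Prod>i<2. D i \<omega>) \<partial>M) = (\<Prod>i<2. \<integral>\<^sup>+\<omega>. D i \<omega> \<partial>M)"
      by (intro indep_vars_nn_integral) auto
    have "(\<integral>\<^sup>+\<omega>. ennreal (exp (u * X (s + h) \<omega>)) \<partial>M) = (\<integral>\<^sup>+\<omega>. (\<Prod>i<2. D i \<omega>) \<partial>M)"
    proof (rule nn_integral_cong_AE, use X0 in eventually_elim)
      fix \<omega> assume "X 0 \<omega> = 0"
      then show "ennreal (exp (u * X (s + h) \<omega>)) = (\<Prod>i<2. D i \<omega>)"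
        by (simp add: D_def t_def numeral_2_eq_2 algebra_simps flip: ennreal_mult' exp_add)
    qed
    also have "\<dots> = (\<integral>\<^sup>+\<omega>. D 0 \<omega> \<partial>M) * (\<integral>\<^sup>+\<omega>. D 1 \<omega> \<partial>M)"
      unfolding prod by (simp add: numeral_2_eq_2)
    also have "(\<integral>\<^sup>+\<omega>. D 0 \<omega> \<partial>M) = (\<integral>\<^sup>+\<omega>. ennreal (exp (u * X s \<omega>)) \<partial>M)"
      by (rule nn_integral_cong_AE, use X0 in eventually_elim) (simp add: D_def t_def)
    also have "(\<integral>\<^sup>+\<omega>. D 1 \<omega> \<partial>M) = (\<integral>\<^sup>+\<omega>. ennreal (exp (u * X h \<omega>)) \<partial>M)"
    proof -
      have "distr M borel (\<lambda>\<omega>. X (s + h) \<omega> - X s \<omega>) = distr M borel (X h)"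
        using X s h by (auto simp: levy_process_def)
      then have "(\<integral>\<^sup>+x. ennreal (exp (u * x)) \<partial>distr M borel (\<lambda>\<omega>. X (s + h) \<omega> - X s \<omega>)) =
          (\<integral>\<^sup>+x. ennreal (exp (u * x)) \<partial>distr M borel (X h))" by simp
      then show ?thesis
        using meas[of s] meas[of h] meas[of "s + h"] s h
        by (simp add: nn_integral_distr D_def t_def)
    qed
    finally show ?thesis .
  qed (use \<phi>0 in auto)
qed

text \<open>The function \<open>g\<close> below is additive on the half-line and vanishes at \<open>1\<close>, hence at the rationals.
  So \<open>g \<le> 0\<close> by Fatou and right-continuity of the paths, and \<open>g t + g (n - t) = 0\<close> gives \<open>g = 0\<close>.\<close>

lemma levy_exp_moment:
  fixes X :: "real \<Rightarrow> 'a \<Rightarrow> real"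
  assumes X: "levy_process M X" and int: "integrable M (\<lambda>\<omega>. exp (u \<bullet> X 1 \<omega>))" and t: "0 \<le> t"
  shows "(\<integral>\<^sup>+\<omega>. ennreal (exp (u * X t \<omega>)) \<partial>M) = ennreal (exp (t * cgf M (X 1) u))"
proof -
  define \<phi> where "\<phi> t = (\<integral>\<^sup>+\<omega>. ennreal (exp (u * X t \<omega>)) \<partial>M)" for t
  have meas: "X t \<in> borel_measurable M" if "0 \<le> t" for t
    using X that by (auto simp: levy_process_def)
  have add: "\<phi> (s + h) = \<phi> s * \<phi> h" if "0 \<le> s" "0 \<le> h" for s h
    unfolding \<phi>_def by (rule levy_exp_moment_add[OF X that])
  have nz: "\<phi> t \<noteq> 0" if "0 \<le> t" for t
  proof
    assume "\<phi> t = 0"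
    then have "AE \<omega> in M. ennreal (exp (u * X t \<omega>)) = 0"
      unfolding \<phi>_def by (subst (asm) nn_integral_0_iff_AE) (use meas[OF that] in simp_all)
    then show False by simp
  qed
  have \<phi>1: "\<phi> 1 = ennreal (mgf M (X 1) u)"
    unfolding \<phi>_def mgf_def using nn_integral_eq_integral[OF int] by simp
  have \<phi>n: "\<phi> (real n) \<noteq> \<infinity>" for n
  proof (induction n)
    case 0
    have "\<phi> 1 = \<phi> 0 * \<phi> 1" using add[of 0 1] by simp
    then show ?case using \<phi>1 nz[of 1] by (auto simp: ennreal_top_mult)
  next
    case (Suc n)
    then show ?case using add[of "real n" 1] \<phi>1 by (simp add: add.commute ennreal_mult_eq_top_iff)
  qed
  \<comment> \<open>A factor of a finite product is finite when the other factor is nonzero; t is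
    completed to an integer time.\<close>
  have fin: "\<phi> t \<noteq> \<infinity>" if "0 \<le> t" for t
  proof -
    obtain n where "t \<le> real n" using real_arch_simple by blast
    then have "\<phi> (real n) = \<phi> t * \<phi> (real n - t)" using add[of t "real n - t"] that by simp
    then show ?thesis using \<phi>n[of n] nz[of "real n - t"] \<open>t \<le> real n\<close>
      by (auto simp: ennreal_top_mult)
  qed
  \<comment> \<open>\<open>nz\<close> and \<open>fin\<close> exclude the values 0 and \<infinity>,
    at which \<open>enn2real\<close> would return 0.\<close>
  define f where "f t = ln (enn2real (\<phi> t))" for t
  have pos: "0 < enn2real (\<phi> t)" if "0 \<le> t" for t
    using nz[OF that] fin[OF that] by (simp add: enn2real_positive_iff less_top zero_less_iff_neq_zero)
  have \<phi>f: "\<phi> t = ennreal (exp (f t))" if "0 \<le> t" for t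
    using pos[OF that] fin[OF that] by (simp add: f_def ennreal_enn2real less_top)
  have f1: "f 1 = cgf M (X 1) u"
    by (simp add: f_def \<phi>1 cgf_def mgf_def)
  define g where "g t = f t - t * f 1" for t
  have g_add: "g (s + h) = g s + g h" if "0 \<le> s" "0 \<le> h" for s h
  proof -
    have "f (s + h) = f s + f h"
      unfolding f_def add[OF that] using pos[OF that(1)] pos[OF that(2)] by (simp add: enn2real_mult ln_mult)
    then show ?thesis by (simp add: g_def algebra_simps)
  qed
  have g_mult: "g (real n * x) = real n * g x" if "0 \<le> x" for n x
  proof (induction n)
    case 0
    then show ?case using g_add[of 0 0] by simp
  next
    case (Suc n)
    then show ?case using g_add[of "real n * x" x] that by (simp add: algebra_simps)
  qed
  have g_nat: "g (real n) = 0" for n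
    using g_mult[of 1 n] by (simp add: g_def)
  have g_rat: "g (real m / real (Suc n)) = 0" for m n
  proof -
    have "real (Suc n) * g (real m / real (Suc n)) = g (real m)"
      by (subst g_mult[symmetric]) (simp_all del: of_nat_Suc)
    then show ?thesis by (simp add: g_nat del: of_nat_Suc)
  qed
  have g_le: "g t \<le> 0" if t: "0 \<le> t" for t
  proof -
    have grid: "g (right_grid n t) = 0" for n
      using g_rat[of "Suc (nat \<lfloor>real (Suc n) * t\<rfloor>)" n] by (simp add: right_grid_def add.commute)
    have grid0: "0 \<le> right_grid n t" for n using right_grid_bounds[OF t, of n] t by simp
    have "\<phi> t = (\<integral>\<^sup>+\<omega>. liminf (\<lambda>n. ennreal (exp (u * X (right_grid n t) \<omega>))) \<partial>M)"
      unfolding \<phi>_def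
    proof (rule nn_integral_cong)
      fix \<omega> assume "\<omega> \<in> space M"
      have "(\<lambda>n. ennreal (exp (u * X (right_grid n t) \<omega>))) \<longlonglongrightarrow> ennreal (exp (u * X t \<omega>))"
        by (intro tendsto_intros levy_right_limit[OF X \<open>\<omega> \<in> space M\<close> t])
      from lim_imp_Liminf[OF _ this]
      show "ennreal (exp (u * X t \<omega>)) = liminf (\<lambda>n. ennreal (exp (u * X (right_grid n t) \<omega>)))" by simp
    qed
    also have "\<dots> \<le> liminf (\<lambda>n. \<phi> (right_grid n t))"
      unfolding \<phi>_def by (rule nn_integral_liminf) (use meas[OF grid0] in simp)
    also have "\<dots> = ennreal (exp (t * f 1))"
    proof (rule lim_imp_Liminf)
      have "(\<lambda>n. right_grid n t) \<longlonglongrightarrow> t"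
        using filterlim_right_grid[OF t] by (simp add: filterlim_at)
      then have "(\<lambda>n. ennreal (exp (right_grid n t * f 1))) \<longlonglongrightarrow> ennreal (exp (t * f 1))"
        by (intro tendsto_intros)
      moreover have "\<phi> (right_grid n t) = ennreal (exp (right_grid n t * f 1))" for n
        using \<phi>f[OF grid0] grid[of n] by (simp add: g_def)
      ultimately show "(\<lambda>n. \<phi> (right_grid n t)) \<longlonglongrightarrow> ennreal (exp (t * f 1))" by simp
    qed simp
    finally show ?thesis using \<phi>f[OF t] by (simp add: g_def)
  qed
  obtain n where n: "t \<le> real n" using real_arch_simple by blast
  have "g t + g (real n - t) = 0" using g_add[of t "real n - t"] n t g_nat[of n] by simp
  then have "g t = 0" using g_le[OF t] g_le[of "real n - t"] n by simp
  then show ?thesis using \<phi>f[OF t] f1 by (simp add: g_def \<phi>_def)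
qed

end

section \<open>Subordination\<close>

definition grid_exp :: "real ^ 'd \<Rightarrow> nat \<Rightarrow> (real ^ 'd) \<times> (real \<Rightarrow> real ^ 'd) \<Rightarrow> ennreal" where
  "grid_exp w n = (\<lambda>(\<tau>, x). ennreal (exp (\<Sum>k\<in>UNIV. w $ k * x (right_grid n (\<tau> $ k)) $ k)))"

text \<open>For fixed n the time index is a measurable function with countably many values, and at
  each fixed time evaluation of a path is a coordinate projection.\<close>

lemma measurable_grid_exp [measurable]:
  fixes w :: "real ^ 'd"
  shows "grid_exp w n \<in> borel_measurable (borel \<Otimes>\<^sub>M path_space)"
proof -
  have "(\<lambda>p :: (real ^ 'd) \<times> (real \<Rightarrow> real ^ 'd). snd p (right_grid n (fst p $ k)) $ k)
      \<in> borel_measurable (borel \<Otimes>\<^sub>M path_space)" for k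
  proof -
    have "(\<lambda>p :: (real ^ 'd) \<times> (real \<Rightarrow> real ^ 'd). snd p ((real m + 1) / real (Suc n)) $ k)
        \<in> borel_measurable (borel \<Otimes>\<^sub>M path_space)" for m
    proof -
      have "(\<lambda>x. x ((real m + 1) / real (Suc n))) \<in> measurable (path_space :: (real \<Rightarrow> real ^ 'd) measure) borel"
        by (rule measurable_component_singleton) simp
      then show ?thesis
        by (intro measurable_compose[OF measurable_snd] measurable_compose[OF _ borel_measurable_nth])
    qed
    moreover have "(\<lambda>p :: (real ^ 'd) \<times> (real \<Rightarrow> real ^ 'd). nat \<lfloor>real (Suc n) * fst p $ k\<rfloor>)
        \<in> measurable (borel \<Otimes>\<^sub>M path_space) (count_space UNIV)"
    proof -
      have [measurable]: "(\<lambda>p :: (real ^ 'd) \<times> (real \<Rightarrow> real ^ 'd). fst p $ k) \<in> borel_measurable (borel \<Otimes>\<^sub>M path_space)"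
        by (rule measurable_compose[OF measurable_fst borel_measurable_nth])
      show ?thesis by measurable
    qed
    ultimately show ?thesis
      unfolding right_grid_def by (rule measurable_compose_countable)
  qed
  then show ?thesis unfolding grid_exp_def case_prod_unfold by measurable
qed

text \<open>The evaluation \<open>(\<tau>, x) \<mapsto> x \<tau>\<close> is not measurable on the path space; its approximation along a
  countable grid is, and agrees with it on cadlag paths.\<close>

lemma liminf_grid_exp:
  fixes Z :: "'d::finite \<Rightarrow> real \<Rightarrow> 'a \<Rightarrow> real"
  assumes Z: "\<And>k. levy_process M (Z k)" and \<omega>: "\<omega> \<in> space M" and \<tau>: "\<And>k. 0 \<le> \<tau> $ k"
  shows "liminf (\<lambda>n. grid_exp w n (\<tau>, path (joint_process Z) \<omega>)) =
    ennreal (exp (\<Sum>k\<in>UNIV. w $ k * Z k (\<tau> $ k) \<omega>))"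
proof (rule lim_imp_Liminf)
  have "0 \<le> right_grid n (\<tau> $ k)" for n k using right_grid_bounds[OF \<tau>[of k], of n] \<tau>[of k] by simp
  then have "grid_exp w n (\<tau>, path (joint_process Z) \<omega>) =
      ennreal (exp (\<Sum>k\<in>UNIV. w $ k * Z k (right_grid n (\<tau> $ k)) \<omega>))" for n
    by (simp add: grid_exp_def path_def joint_process_def)
  moreover have "(\<lambda>n. ennreal (exp (\<Sum>k\<in>UNIV. w $ k * Z k (right_grid n (\<tau> $ k)) \<omega>))) \<longlonglongrightarrow>
      ennreal (exp (\<Sum>k\<in>UNIV. w $ k * Z k (\<tau> $ k) \<omega>))"
    by (intro tendsto_intros levy_right_limit[OF Z \<omega> \<tau>])
  ultimately show "(\<lambda>n. grid_exp w n (\<tau>, path (joint_process Z) \<omega>)) \<longlonglongrightarrow>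
      ennreal (exp (\<Sum>k\<in>UNIV. w $ k * Z k (\<tau> $ k) \<omega>))" by simp
qed simp

text \<open>The paths of T and of the joint process have a product law, so by Tonelli the inner
  integral is taken with T(1) frozen. It then factorises by independence of the Z_k, each factor
  being an exponential moment at a deterministic time.\<close>

lemma (in prob_space) subordinated_exp_moment:
  fixes Z :: "'d::finite \<Rightarrow> real \<Rightarrow> 'a \<Rightarrow> real" and T :: "real \<Rightarrow> 'a \<Rightarrow> real ^ 'd"
  assumes Z: "\<And>k. levy_process M (Z k)" and indZ: "indep_processes M Z"
    and T: "multivariate_subordinator M T" and ind: "indep_two_processes M T (joint_process Z)"
    and int: "\<And>k. integrable M (\<lambda>\<omega>. exp (w $ k \<bullet> Z k 1 \<omega>))"
  defines "E \<equiv> \<lambda>\<omega>. exp (\<Sum>k\<in>UNIV. w $ k * Z k (T 1 \<omega> $ k) \<omega>)"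
  shows "E \<in> borel_measurable M"
    and "(\<integral>\<^sup>+\<omega>. ennreal (E \<omega>) \<partial>M) =
      (\<integral>\<^sup>+\<omega>. ennreal (exp (\<Sum>k\<in>UNIV. cgf M (Z k 1) (w $ k) * T 1 \<omega> $ k)) \<partial>M)"
proof -
  define J where "J = path (joint_process Z)"
  define U where "U = path T"
  \<comment> \<open>The first argument is a whole path of T because independence is assumed for
    paths; only its value at time 1 enters.\<close>
  define H where "H = (\<lambda>(y :: real \<Rightarrow> real ^ 'd, x). liminf (\<lambda>n. grid_exp w n (y 1, x)))"
  have "(\<lambda>y. y 1) \<in> measurable (path_space :: (real \<Rightarrow> real ^ 'd) measure) borel"
    by (rule measurable_component_singleton) simp
  then have [measurable]: "(\<lambda>p :: (real \<Rightarrow> real ^ 'd) \<times> _. (fst p 1, snd p)) \<in> measurable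
      (path_space \<Otimes>\<^sub>M path_space) (borel \<Otimes>\<^sub>M (path_space :: (real \<Rightarrow> real ^ 'd) measure))"
    by (intro measurable_Pair measurable_snd) (rule measurable_compose[OF measurable_fst])
  have H [measurable]: "H \<in> borel_measurable (path_space \<Otimes>\<^sub>M path_space)"
    unfolding H_def case_prod_unfold by (intro borel_measurable_liminf measurable_compose[OF _ measurable_grid_exp]) measurable
  have T0: "0 \<le> T 1 \<omega> $ k" if "\<omega> \<in> space M" for \<omega> k
    using T that by (auto simp: multivariate_subordinator_def)
  have T1 [measurable]: "T 1 \<in> borel_measurable M"
    using T by (auto simp: multivariate_subordinator_def levy_process_def)
  have indUJ: "indep_var path_space U path_space J"
    using ind by (simp add: indep_two_processes_def J_def U_def)
  then have U [measurable]: "U \<in> measurable M path_space" and J [measurable]: "J \<in> measurable M path_space"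
    using indep_var_rv1 indep_var_rv2 by blast+
  have U1: "U \<omega> 1 = T 1 \<omega>" for \<omega> by (simp add: U_def path_def)
  have HE: "H (U \<omega>, J \<omega>) = ennreal (E \<omega>)" if "\<omega> \<in> space M" for \<omega>
    unfolding H_def prod.case U1 J_def E_def by (rule liminf_grid_exp[OF Z that T0[OF that]])
  \<comment> \<open>Evaluation at the random times T_k(1) is replaced by the measurable functional
    \<open>H\<close> of the two paths.\<close>
  have mE: "(\<lambda>\<omega>. ennreal (E \<omega>)) \<in> borel_measurable M"
    by (subst measurable_cong[OF HE[symmetric]]) measurable
  then have "(\<lambda>\<omega>. enn2real (ennreal (E \<omega>))) \<in> borel_measurable M" by measurable
  then show "E \<in> borel_measurable M" by (simp add: E_def)
  have inner: "(\<integral>\<^sup>+\<omega>'. H (y, J \<omega>') \<partial>M) = ennreal (exp (\<Sum>k\<in>UNIV. cgf M (Z k 1) (w $ k) * y 1 $ k))"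
    if \<tau>: "\<And>k. 0 \<le> y 1 $ k" for y
  proof -
    have "indep_vars (\<lambda>_. path_space) (\<lambda>k. path (Z k)) UNIV"
      using indZ by (simp add: indep_processes_def)
    from indep_vars_compose2[OF this, of "\<lambda>k x. ennreal (exp (w $ k * x (y 1 $ k)))" "\<lambda>_. borel"]
    have "indep_vars (\<lambda>_. borel) (\<lambda>k \<omega>'. ennreal (exp (w $ k * path (Z k) \<omega>' (y 1 $ k)))) UNIV"
      using \<tau> by simp
    then have iv: "indep_vars (\<lambda>_. borel) (\<lambda>k \<omega>'. ennreal (exp (w $ k * Z k (y 1 $ k) \<omega>'))) UNIV"
      using \<tau> by (simp add: path_def)
    have "(\<integral>\<^sup>+\<omega>'. H (y, J \<omega>') \<partial>M) = (\<integral>\<^sup>+\<omega>'. (\<Prod>k\<in>UNIV. ennreal (exp (w $ k * Z k (y 1 $ k) \<omega>'))) \<partial>M)"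
    proof (rule nn_integral_cong)
      fix \<omega>' assume "\<omega>' \<in> space M"
      from liminf_grid_exp[OF Z this \<tau>]
      show "H (y, J \<omega>') = (\<Prod>k\<in>UNIV. ennreal (exp (w $ k * Z k (y 1 $ k) \<omega>')))"
        by (simp add: H_def J_def exp_sum prod_ennreal)
    qed
    also have "\<dots> = (\<Prod>k\<in>UNIV. \<integral>\<^sup>+\<omega>'. ennreal (exp (w $ k * Z k (y 1 $ k) \<omega>')) \<partial>M)"
      by (rule indep_vars_nn_integral[OF _ iv]) auto
    also have "\<dots> = ennreal (exp (\<Sum>k\<in>UNIV. cgf M (Z k 1) (w $ k) * y 1 $ k))"
      by (simp add: levy_exp_moment[OF Z int \<tau>] exp_sum prod_ennreal mult.commute)
    finally show ?thesis .
  qed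
  interpret PJ: prob_space "distr M path_space J" by (rule prob_space_distr) measurable
  have "(\<integral>\<^sup>+\<omega>. ennreal (E \<omega>) \<partial>M) = (\<integral>\<^sup>+\<omega>. H (U \<omega>, J \<omega>) \<partial>M)"
    by (rule nn_integral_cong) (simp add: HE)
  also have "\<dots> = (\<integral>\<^sup>+p. H p \<partial>distr M (path_space \<Otimes>\<^sub>M path_space) (\<lambda>\<omega>. (U \<omega>, J \<omega>)))"
    by (subst nn_integral_distr) measurable
  also have "\<dots> = (\<integral>\<^sup>+p. H p \<partial>(distr M path_space U \<Otimes>\<^sub>M distr M path_space J))"
    using indUJ by (simp add: indep_var_distribution_eq)
  also have "\<dots> = (\<integral>\<^sup>+y. \<integral>\<^sup>+x. H (y, x) \<partial>distr M path_space J \<partial>distr M path_space U)"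
    by (rule PJ.nn_integral_fst[symmetric]) (simp cong: measurable_cong_sets)
  also have "\<dots> = (\<integral>\<^sup>+\<omega>. \<integral>\<^sup>+x. H (U \<omega>, x) \<partial>distr M path_space J \<partial>M)"
    by (subst nn_integral_distr) (auto intro!: PJ.borel_measurable_nn_integral)
  also have "\<dots> = (\<integral>\<^sup>+\<omega>. \<integral>\<^sup>+\<omega>'. H (U \<omega>, J \<omega>') \<partial>M \<partial>M)"
    by (intro nn_integral_cong nn_integral_distr) measurable
  also have "\<dots> = (\<integral>\<^sup>+\<omega>. ennreal (exp (\<Sum>k\<in>UNIV. cgf M (Z k 1) (w $ k) * T 1 \<omega> $ k)) \<partial>M)"
    by (rule nn_integral_cong) (simp add: inner T0 U1)
  finally show "(\<integral>\<^sup>+\<omega>. ennreal (E \<omega>) \<partial>M) =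
      (\<integral>\<^sup>+\<omega>. ennreal (exp (\<Sum>k\<in>UNIV. cgf M (Z k 1) (w $ k) * T 1 \<omega> $ k)) \<partial>M)" .
qed

section \<open>Cumulants of the subordinated process\<close>

lemma inner_matrix_vector_column:
  fixes A :: "real ^ 'd ^ 'n"
  shows "z \<bullet> (A *v v) = (\<Sum>k\<in>UNIV. (column k A \<bullet> z) * v $ k)"
proof -
  have "z \<bullet> (A *v v) = (\<Sum>p\<in>UNIV. \<Sum>k\<in>UNIV. z $ p * (A $ p $ k * v $ k))"
    by (simp add: inner_vec_def matrix_vector_mult_def sum_distrib_left)
  also have "\<dots> = (\<Sum>k\<in>UNIV. \<Sum>p\<in>UNIV. z $ p * (A $ p $ k * v $ k))" by (rule sum.swap)
  also have "\<dots> = (\<Sum>k\<in>UNIV. (column k A \<bullet> z) * v $ k)"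
    unfolding inner_vec_def sum_distrib_right by (intro sum.cong refl) (simp add: column_def)
  finally show ?thesis .
qed

text \<open>The coefficients of the linear form z . A v in v are the products of z with the columns
  of A. The identity of nonnegative integrals transfers finiteness from T(1) to Y.\<close>

lemma (in prob_space) mgf_subordinated_process:
  fixes Z :: "'d::finite \<Rightarrow> real \<Rightarrow> 'a \<Rightarrow> real" and A :: "real ^ 'd ^ 'n"
  assumes Z: "\<And>k. levy_process M (Z k)" and indZ: "indep_processes M Z"
    and T: "multivariate_subordinator M T" and ind: "indep_two_processes M T (joint_process Z)"
    and intZ: "\<And>k. integrable M (\<lambda>\<omega>. exp ((column k A \<bullet> z) \<bullet> Z k 1 \<omega>))"
    and intT: "integrable M (\<lambda>\<omega>. exp ((\<chi> k. cgf M (Z k 1) (column k A \<bullet> z)) \<bullet> T 1 \<omega>))"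
  shows "integrable M (\<lambda>\<omega>. exp (z \<bullet> subordinated_process A Z T 1 \<omega>))"
    and "mgf M (subordinated_process A Z T 1) z =
      mgf M (T 1) (\<chi> k. cgf M (Z k 1) (column k A \<bullet> z))"
proof -
  define w :: "real ^ 'd" where "w = (\<chi> k. column k A \<bullet> z)"
  have E: "exp (z \<bullet> subordinated_process A Z T 1 \<omega>) = exp (\<Sum>k\<in>UNIV. w $ k * Z k (T 1 \<omega> $ k) \<omega>)" for \<omega>
    by (simp add: subordinated_process_def inner_matrix_vector_column w_def)
  have F: "exp ((\<chi> k. cgf M (Z k 1) (column k A \<bullet> z)) \<bullet> T 1 \<omega>) =
      exp (\<Sum>k\<in>UNIV. cgf M (Z k 1) (w $ k) * T 1 \<omega> $ k)" for \<omega>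
    by (simp add: w_def inner_vec_def)
  have int: "integrable M (\<lambda>\<omega>. exp (w $ k \<bullet> Z k 1 \<omega>))" for k
    using intZ[of k] by (simp add: w_def)
  note sub = subordinated_exp_moment[OF Z indZ T ind int]
  have nn: "(\<integral>\<^sup>+\<omega>. ennreal (exp (z \<bullet> subordinated_process A Z T 1 \<omega>)) \<partial>M) =
      ennreal (mgf M (T 1) (\<chi> k. cgf M (Z k 1) (column k A \<bullet> z)))"
    unfolding mgf_def E sub(2) F[symmetric] by (rule nn_integral_eq_integral[OF intT]) simp
  have meas: "(\<lambda>\<omega>. exp (z \<bullet> subordinated_process A Z T 1 \<omega>)) \<in> borel_measurable M"
    unfolding E by (rule sub(1))
  show "integrable M (\<lambda>\<omega>. exp (z \<bullet> subordinated_process A Z T 1 \<omega>))"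
    using meas nn by (intro integrableI_nonneg) auto
  show "mgf M (subordinated_process A Z T 1) z =
      mgf M (T 1) (\<chi> k. cgf M (Z k 1) (column k A \<bullet> z))"
    unfolding mgf_def[of M "subordinated_process A Z T 1"]
    by (rule trans[OF integral_eq_nn_integral[OF meas]])
      (simp_all add: nn, simp add: mgf_def)
qed

theorem theorem2p1:
  fixes M :: "'a measure"
    and Z :: "'d::finite \<Rightarrow> real \<Rightarrow> 'a \<Rightarrow> real"
    and T :: "real \<Rightarrow> 'a \<Rightarrow> real ^ 'd"
    and A :: "real ^ 'd ^ 'n::{finite,linorder}"
    and Y :: "'a \<Rightarrow> real ^ 'n::{finite,linorder}"
    and g :: "'d \<Rightarrow> nat ^ 'n::{finite,linorder} \<Rightarrow> real"
    and i :: "nat ^ 'n::{finite,linorder}"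
  assumes "prob_space M"
    and "\<And>k. levy_process M (Z k)"
    and "indep_processes M Z"
    and "multivariate_subordinator M T"
    and "indep_two_processes M T (joint_process Z)"
    and "\<And>k. mgf_finite_near_0 M (Z k 1)"
    and "mgf_finite_near_0 M (T 1)"
    and Y_def: "Y = subordinated_process A Z T 1"
    and g_def: "\<And>k \<mu>. g k \<mu> = cumulant M (Z k 1) (mi_abs \<mu>) * mi_power (column k A) \<mu>"
  shows "mgf_finite_near_0 M Y \<and>
    joint_cumulant M Y i = umbral_eval (joint_cumulant M (T 1)) (gen_bell g i indet)"
proof -
  interpret prob_space M by fact
  have Z1: "Z k 1 \<in> borel_measurable M" for k
    using assms(2)[of k] by (auto simp: levy_process_def)
  have T1: "T 1 \<in> borel_measurable M"
    using assms(4) by (auto simp: multivariate_subordinator_def levy_process_def)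
  define a where "a j = joint_cumulant M (T 1) j / mi_fact j" for j
  define b where "b k \<mu> = g k \<mu> / mi_fact \<mu>" for k \<mu>
  define K where "K z = (\<chi> k. cgf M (Z k 1) (column k A \<bullet> z))" for z
  have a: "has_mps a (cgf M (T 1))"
    using has_joint_cumulants_joint_cumulant[OF T1 assms(7)]
    by (simp add: has_joint_cumulants_iff a_def[abs_def])
  have b: "has_mps (b k) (\<lambda>z. cgf M (Z k 1) (column k A \<bullet> z))" for k
  proof -
    obtain r where "r > 0"
      "\<And>u. \<bar>u\<bar> < r \<Longrightarrow> (\<lambda>j. cumulant M (Z k 1) j * (u ^ j / fact j)) sums cgf M (Z k 1) u"
      using has_cumulants_cumulant[OF Z1 assms(6), of k] by (auto simp: has_cumulants_def)
    from has_mps_linear_form[OF this, of "column k A"] show ?thesis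
      by (simp add: b_def[abs_def] g_def)
  qed
  have b0: "b k 0 = 0" for k
    using cumulant_0[OF Z1 assms(6), of k] by (simp add: b_def g_def)
  have comp: "has_mps (comp_coeff a b) (\<lambda>z. cgf M (T 1) (K z))"
    unfolding K_def by (rule has_mps_compose[OF a b b0])
  have "\<exists>r>0. \<forall>u. \<bar>u\<bar> < r \<longrightarrow> integrable M (\<lambda>\<omega>. exp (u \<bullet> Z k 1 \<omega>))" for k
    using assms(6)[of k] by (auto simp: mgf_finite_near_0_def)
  then obtain r where r: "\<And>k. r k > 0"
    "\<And>k u. \<bar>u\<bar> < r k \<Longrightarrow> integrable M (\<lambda>\<omega>. exp (u \<bullet> Z k 1 \<omega>))"
    by metis
  obtain e where e: "e > 0" "\<And>u. norm u < e \<Longrightarrow> integrable M (\<lambda>\<omega>. exp (u \<bullet> T 1 \<omega>))"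
    using assms(7) by (auto simp: mgf_finite_near_0_def)
  \<comment> \<open>Ensures that K z lies where the moment generating function of T(1) is finite.
    Continuity at 0 is read off the absolute series, which becomes arbitrarily small because
    \<open>b k 0 = 0\<close>.\<close>
  have "(K \<longlongrightarrow> 0) (nhds 0)"
  proof (rule vec_tendstoI)
    fix k
    show "((\<lambda>z. K z $ k) \<longlongrightarrow> 0 $ k) (nhds 0)"
    proof (rule tendstoI)
      fix q :: real assume q: "q > 0"
      obtain \<delta> where \<delta>: "\<delta> > 0"
        "\<And>z. norm z < \<delta> \<Longrightarrow> \<exists>B\<le>q/2. ((\<lambda>j. \<bar>b k j * mi_power z j\<bar>) has_sum B) UNIV"
        by (rule has_mps_abs_small[OF b[of k] b0[of k], of "q/2"]) (use q in auto)
      obtain \<delta>' where \<delta>': "\<delta>' > 0"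
        "\<And>z. norm z < \<delta>' \<Longrightarrow> ((\<lambda>j. b k j * mi_power z j) has_sum K z $ k) UNIV"
        using b[of k] by (auto simp: has_mps_def K_def)
      have "\<bar>K z $ k\<bar> < q" if "norm z < min \<delta> \<delta>'" for z
      proof -
        have z: "norm z < \<delta>" "norm z < \<delta>'" using that by auto
        obtain B where "B \<le> q/2" "((\<lambda>j. \<bar>b k j * mi_power z j\<bar>) has_sum B) UNIV"
          using \<delta>(2)[OF z(1)] by blast
        moreover have "((\<lambda>j. b k j * mi_power z j) has_sum K z $ k) UNIV" using \<delta>'(2)[OF z(2)] .
        ultimately show ?thesis
          using norm_has_sum_bound[of "\<lambda>j. b k j * mi_power z j" UNIV B "K z $ k"] q by simp
      qed
      then show "\<forall>\<^sub>F z in nhds 0. dist (K z $ k) (0 $ k) < q"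
        using \<delta>(1) \<delta>'(1) by (auto simp: eventually_nhds_metric intro!: exI[of _ "min \<delta> \<delta>'"])
    qed
  qed
  then have "\<forall>\<^sub>F z in nhds 0. norm (K z) < e"
    using e(1) by (auto dest: tendstoD)
  moreover have "\<forall>\<^sub>F z in nhds 0. \<forall>k. \<bar>column k A \<bullet> z\<bar> < r k"
  proof (rule eventually_all_finite)
    fix k
    have "((\<lambda>z. \<bar>column k A \<bullet> z\<bar>) \<longlongrightarrow> \<bar>column k A \<bullet> 0\<bar>) (nhds 0)"
      by (intro tendsto_intros filterlim_ident)
    then show "\<forall>\<^sub>F z in nhds 0. \<bar>column k A \<bullet> z\<bar> < r k"
      using r(1)[of k] by (intro order_tendstoD(2)) auto
  qed
  ultimately have "\<forall>\<^sub>F z in nhds 0. integrable M (\<lambda>\<omega>. exp (z \<bullet> Y \<omega>)) \<and> mgf M Y z = mgf M (T 1) (K z)"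
  proof eventually_elim
    fix z assume z: "norm (K z) < e" "\<forall>k. \<bar>column k A \<bullet> z\<bar> < r k"
    show "integrable M (\<lambda>\<omega>. exp (z \<bullet> Y \<omega>)) \<and> mgf M Y z = mgf M (T 1) (K z)"
      unfolding Y_def K_def using z
      by (intro conjI mgf_subordinated_process assms r(2) e(2)) (auto simp: K_def)
  qed
  then obtain \<delta> where \<delta>: "\<delta> > 0" "\<And>z. norm z < \<delta> \<Longrightarrow> integrable M (\<lambda>\<omega>. exp (z \<bullet> Y \<omega>))"
    "\<And>z. norm z < \<delta> \<Longrightarrow> mgf M Y z = mgf M (T 1) (K z)"
    by (auto simp: eventually_nhds_metric)
  have fin: "mgf_finite_near_0 M Y"
    using \<delta>(1,2) by (auto simp: mgf_finite_near_0_def)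
  obtain \<eta> where \<eta>: "\<eta> > 0"
    "\<And>z. norm z < \<eta> \<Longrightarrow> ((\<lambda>j. comp_coeff a b j * mi_power z j) has_sum cgf M (T 1) (K z)) UNIV"
    using comp by (auto simp: has_mps_def)
  have "has_mps (comp_coeff a b) (cgf M Y)"
    unfolding has_mps_def
    by (rule exI[of _ "min \<delta> \<eta>"]) (use \<delta>(1,3) \<eta> in \<open>simp add: cgf_def\<close>)
  moreover have "mi_fact j * comp_coeff a b j / mi_fact j = comp_coeff a b j" for j
    using mi_fact_pos[of j] by simp
  ultimately have "has_joint_cumulants M Y (\<lambda>j. mi_fact j * comp_coeff a b j)"
    using fin by (simp add: has_joint_cumulants_iff)
  from joint_cumulant_eq[OF this]
  have "joint_cumulant M Y i = mi_fact i * comp_coeff a b i" by simp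
  also have "\<dots> = umbral_eval (joint_cumulant M (T 1)) (gen_bell g i indet)"
    unfolding a_def b_def by (rule comp_coeff_eq_umbral_eval)
  finally show ?thesis using fin by simp
qed

end
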